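(* Let $g:\mathbb{R}^N\to\mathbb{R}$ be positive ($g(t)\ge0$ for all $t$), symmetric (invariant under permutations of $(t_1,\dots,t_N)$), and such that $\int_{\mathbb{R}^N}g(t)(V(t))^2dt<\infty$. For $x\in M$ with eigenvalues $\rho=(\rho_1,\dots,\rho_N)$, let $$f(x)=\frac{1}{V(\mathrm{i}\rho)}\times\frac{1}{N!}\int_{\mathbb{R}^N}g(t)\,V(t)\,\det\!\left[\rho_k^{\mathrm{i}t_\ell+(N-1)/2}\right]_{k,\ell=1}^N dt .$$ (a) Assume that $g(t)=\gamma(t_1)\cdots\gamma(t_N)$ where $\gamma:\mathbb{R}\to\mathbb{R}$ is a positive function ($\gamma\ge 0$). Then $$f(x)=\frac{(\det x)^{(N-1)/2}}{V(\mathrm{i}\rho)}\times\det\!\left[\int_{\mathbb{R}}\gamma(t)\,t^{k-1}e^{\mathrm{i}ts_\ell}\,dt\right]_{k,\ell=1}^N,$$ where $s_\ell=\log(\rho_\ell)$ for $\ell=1,\dots,N$. (b) Assume that the inverse Fourier transform $$\tilde g(s)=\int_{\mathbb{R}^N}g(t)\,e^{\mathrm{i}(s,t)}\,dt,\qquad s=(s_1,\dots,s_N)\in\mathbb{R}^N,$$ is well defined ($g$ is integrable) and is a smooth function of $s$. Then $$f(x)=\frac{(\det x)^{(N-1)/2}}{V(\rho)}\times\left.V\!\left(-\frac{\partial}{\partial s}\right)\tilde g(s)\right|_{s_\ell=\log(\rho_\ell)} .$$ (The formulas are for $x$ with pairwise distinct eigenvalues, where the denominators do not vanish; at other $x$ they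 are understood by continuity.)
   Context: $N\ge1$ is an integer and $\mathrm{i}=\sqrt{-1}$. $M$ is the space of $N\times N$ Hermitian positive definite complex matrices. $V(\mu)=\prod_{k<\ell}(\mu_\ell-\mu_k)$ is the Vandermonde polynomial, and $\mathrm{i}\rho=(\mathrm{i}\rho_1,\dots,\mathrm{i}\rho_N)$. $(s,t)=\sum_{k=1}^N s_kt_k$. $V(\partial/\partial s)$ is the differential operator $\prod_{i<j}(\partial/\partial s_j-\partial/\partial s_i)$, and $V(-\partial/\partial s)$ is obtained from it by replacing each $\partial/\partial s_j$ with $-\partial/\partial s_j$. For $\rho>0$ and $z\in\mathbb{C}$, $\rho^z=e^{z\log\rho}$. *)

theory Defs
  imports "HOL-Analysis.Analysis"
begin

text \<open>
  The index set \<open>{1..N}\<close> is a finite linearly ordered type \<open>'n\<close>, so that \<open>N\<close> is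
  \<open>CARD('n)\<close> and \<open>N \<ge> 1\<close> holds automatically. The order is needed for \<open>k < l\<close> in the
  Vandermonde product and for the exponents \<open>k - 1\<close>.
\<close>

definition index_pred :: "'n::{finite,linorder} \<Rightarrow> nat" where
  "index_pred k = card {j. j < k}"  \<comment> \<open>the number \<open>k - 1\<close> if \<open>k\<close> is read as an element of \<open>{1..N}\<close>\<close>

definition vandermonde :: "('a::comm_ring_1) ^ ('n::{finite,linorder}) \<Rightarrow> 'a" where
  "vandermonde \<mu> = (\<Prod>(k, l) \<in> {(k, l). k < l}. \<mu> $ l - \<mu> $ k)"

definition symmetric_fun :: "(real ^ 'n \<Rightarrow> 'b) \<Rightarrow> bool" where
  "symmetric_fun g \<longleftrightarrow> (\<forall>p t. p permutes (UNIV :: 'n set) \<longrightarrow> g (\<chi> i. t $ p i) = g t)"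


definition hpd :: "(complex ^ 'n ^ 'n) set" where
  "hpd = {x. (\<forall>i j. x $ i $ j = cnj (x $ j $ i)) \<and>
             (\<forall>v. v \<noteq> 0 \<longrightarrow> Re (\<Sum>i\<in>UNIV. cnj (v $ i) * (x *v v) $ i) > 0)}"

text \<open>
  \<open>\<rho>\<close> lists the eigenvalues of \<open>x\<close>, in some order and with multiplicity, as the roots of the
  characteristic polynomial.
\<close>

definition eigenvalue_list :: "complex ^ 'n ^ 'n \<Rightarrow> real ^ 'n \<Rightarrow> bool" where
  "eigenvalue_list x \<rho> \<longleftrightarrow> (\<forall>z. det (mat z - x) = (\<Prod>k\<in>UNIV. z - of_real (\<rho> $ k)))"

definition hpd_regular :: "(complex ^ 'n ^ 'n) set" where
  "hpd_regular = {x \<in> hpd. \<exists>\<rho>. eigenvalue_list x \<rho> \<and> inj (\<lambda>k. \<rho> $ k)}"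

text \<open>
  Equality at \<open>x\<close> of two functions that are given on \<open>hpd_regular\<close> and understood by continuity
  at the other points of \<open>hpd\<close>: at such a point, a value is the value by continuity of one of them
  iff it is the value by continuity of the other.
\<close>

definition eq_by_continuity_at ::
    "complex ^ 'n ^ 'n \<Rightarrow> (complex ^ 'n ^ 'n \<Rightarrow> complex) \<Rightarrow> (complex ^ 'n ^ 'n \<Rightarrow> complex) \<Rightarrow> bool" where
  "eq_by_continuity_at x F G \<longleftrightarrow>
     (if x \<in> hpd_regular then F x = G x
      else (\<forall>L. (F \<longlongrightarrow> L) (at x within hpd_regular) \<longleftrightarrow> (G \<longlongrightarrow> L) (at x within hpd_regular)))"


definition partial_deriv :: "'n::finite \<Rightarrow> (real ^ 'n \<Rightarrow> complex) \<Rightarrow> real ^ 'n \<Rightarrow> complex" where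
  "partial_deriv j F s = vector_derivative (\<lambda>h. F (s + h *\<^sub>R axis j 1)) (at 0)"

primrec C_order :: "nat \<Rightarrow> (real ^ 'n \<Rightarrow> complex) \<Rightarrow> bool" where
  "C_order 0 F \<longleftrightarrow> continuous_on UNIV F"
| "C_order (Suc m) F \<longleftrightarrow> (\<forall>s. F differentiable (at s)) \<and> (\<forall>j. C_order m (partial_deriv j F))"

definition smooth :: "(real ^ 'n \<Rightarrow> complex) \<Rightarrow> bool" where
  "smooth F \<longleftrightarrow> (\<forall>m. C_order m F)"

text \<open>
  The operator \<open>\<Prod>i<j. D j - D i\<close>, a composition over the pairs \<open>i < j\<close>. For smooth functions and
  \<open>D = \<plusminus>partial_deriv\<close> the factors commute, so the order of the pairs does not matter.
\<close>

definition vandermonde_op ::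
    "('n \<Rightarrow> (real ^ ('n::{finite,linorder}) \<Rightarrow> complex) \<Rightarrow> real ^ ('n::{finite,linorder}) \<Rightarrow> complex) \<Rightarrow>
     (real ^ ('n::{finite,linorder}) \<Rightarrow> complex) \<Rightarrow> real ^ ('n::{finite,linorder}) \<Rightarrow> complex" where
  "vandermonde_op D =
     foldr (\<lambda>(i, j) F s. D j F s - D i F s)
       [(i, j). i \<leftarrow> sorted_list_of_set UNIV, j \<leftarrow> sorted_list_of_set UNIV, i < j]"


definition inverse_fourier :: "(real ^ 'n \<Rightarrow> real) \<Rightarrow> real ^ 'n \<Rightarrow> complex" where
  "inverse_fourier g s = (\<integral>t. of_real (g t) * exp (\<i> * of_real (s \<bullet> t)) \<partial>lebesgue)"

end

theory Submission
  imports Defs "HOL-Computational_Algebra.Polynomial"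
begin

text \<open>
  Writing \<open>s\<^sub>k = ln \<rho>\<^sub>k\<close>, each entry \<open>\<rho>\<^sub>k powr (\<i> t\<^sub>l + (N-1)/2)\<close> is \<open>\<rho>\<^sub>k powr ((N-1)/2) * exp (\<i> s\<^sub>k t\<^sub>l)\<close>,
  so a power of \<open>det x\<close> factors out of the determinant in \<open>f\<close>. When the remaining determinant is
  expanded over permutations, all \<open>N!\<close> terms have the same integral, because \<open>g V\<close> is
  antisymmetric, and what is left is the integral of \<open>g(t) V(t) exp (\<i> (s,t))\<close>. In (a), \<open>V\<close> is expanded
  as a determinant of powers and Fubini applies; in (b), the integral is a derivative of the inverse
  Fourier transform of \<open>g\<close>.

  Integrability of \<open>g V\<^sup>2\<close> alone justifies neither step. In (a), the first \<open>N - 1\<close> moments of \<open>\<gamma>\<close> are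
  needed; they are finite because, for fixed distinct \<open>t\<^sub>i\<close>, the polynomials \<open>V(t\<^sub>1, \<dots>, u, \<dots>, t\<^sub>N)\<close> in
  \<open>u\<close>, one for each position of \<open>u\<close>, span the polynomials of degree less than \<open>N\<close>. In (b), the partial
  products of \<open>V\<close> need not be integrable against \<open>g\<close> a priori; but \<open>g \<ge> 0\<close>, so smoothness of the
  transform forces all moments of \<open>g\<close> to be finite.
\<close>

subsection \<open>The Vandermonde determinant\<close>

lemma index_pred_less_iff: "index_pred k < index_pred l \<longleftrightarrow> k < l"
proof -
  have mono: "index_pred k < index_pred l" if "k < l" for k l :: 'a
    unfolding index_pred_def by (rule psubset_card_mono) (use that in auto)
  show ?thesis
    using mono[of k l] mono[of l k] by (cases k l rule: linorder_cases) auto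
qed

lemma index_pred_le_iff: "index_pred k \<le> index_pred l \<longleftrightarrow> k \<le> l"
  using index_pred_less_iff[of l k] by (simp add: not_less[symmetric])

lemma inj_index_pred: "inj index_pred"
  by (rule injI) (metis index_pred_le_iff order_antisym order_refl)

lemma index_pred_less_CARD: "index_pred (k :: 'n::{finite,linorder}) < CARD('n)"
  unfolding index_pred_def by (rule psubset_card_mono) auto

lemma bij_betw_index_pred:
  "bij_betw index_pred (UNIV :: 'n::{finite,linorder} set) {..<CARD('n)}"
  unfolding bij_betw_def
proof
  show "index_pred ` (UNIV :: 'n set) = {..<CARD('n)}"
    by (rule card_subset_eq)
       (auto simp: index_pred_less_CARD card_image inj_index_pred)
qed (rule inj_index_pred)

text \<open>A permutation preserves the sum of the ranks. Since no term increases, every term stays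
  the same, and ranks are injective.\<close>

lemma permutes_le_imp_id:
  fixes p :: "'n::{finite,linorder} \<Rightarrow> 'n::{finite,linorder}"
  assumes p: "p permutes UNIV" and le: "\<And>i. p i \<le> i"
  shows "p = id"
proof
  fix i
  have "(\<Sum>i\<in>UNIV. index_pred (p i)) = (\<Sum>i\<in>(UNIV :: 'n set). index_pred i)"
    using sum.permute[OF p, of index_pred] unfolding o_def by (rule sym)
  then have "index_pred (p i) = index_pred i"
    by (rule sum_mono_inv) (auto simp: index_pred_le_iff le)
  then show "p i = id i"
    by (simp add: inj_eq[OF inj_index_pred])
qed

text \<open>By \<open>permutes_le_imp_id\<close>, every permutation other than the identity moves
  some index up and so picks an entry above the diagonal. Only the identity survives in the Leibniz
  formula.\<close>

lemma det_lower_triangular: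
  fixes A :: "'a::comm_ring_1 ^ 'n::{finite,linorder} ^ 'n::{finite,linorder}"
  assumes A: "\<And>i j. i < j \<Longrightarrow> A $ i $ j = 0"
  shows "det A = (\<Prod>i\<in>UNIV. A $ i $ i)"
proof -
  have "det A = (\<Sum>p\<in>{id}. of_int (sign p) * (\<Prod>i\<in>UNIV. A $ i $ p i))"
    unfolding det_def
  proof (rule sum.mono_neutral_right)
    show "\<forall>p\<in>{p. p permutes UNIV} - {id}. of_int (sign p) * (\<Prod>i\<in>UNIV. A $ i $ p i) = 0"
    proof
      fix p :: "'n \<Rightarrow> 'n" assume "p \<in> {p. p permutes UNIV} - {id}"
      then obtain i where "i < p i"
        using permutes_le_imp_id by (metis DiffD1 DiffD2 mem_Collect_eq not_less singletonI)
      then have "(\<Prod>i\<in>UNIV. A $ i $ p i) = 0"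
        using A by (intro prod_zero) auto
      then show "of_int (sign p) * (\<Prod>i\<in>UNIV. A $ i $ p i) = 0"
        by simp
    qed
  qed (auto simp: permutes_id finite_permutations)
  then show ?thesis
    by (simp add: sign_id)
qed

lemma det_upper_triangular:
  fixes A :: "'a::comm_ring_1 ^ 'n::{finite,linorder} ^ 'n::{finite,linorder}"
  assumes "\<And>i j. j < i \<Longrightarrow> A $ i $ j = 0"
  shows "det A = (\<Prod>i\<in>UNIV. A $ i $ i)"
  using det_lower_triangular[of "transpose A"] assms
  by (simp add: det_transpose) (simp add: transpose_def)

lemma sum_index_pred:
  fixes h :: "nat \<Rightarrow> 'a::comm_monoid_add"
  shows "(\<Sum>m\<in>(UNIV :: 'n::{finite,linorder} set). h (index_pred m)) = (\<Sum>i<CARD('n). h i)"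
  by (rule sum.reindex_bij_betw[OF bij_betw_index_pred])

text \<open>Written as coefficients times powers indexed by the type itself, an evaluation becomes
  an entry of a matrix product; \<open>vandermonde_eq_det\<close> reads it in this way.\<close>

lemma poly_eq_sum_index_pred:
  fixes q :: "'a::comm_ring_1 poly"
  assumes "degree q < CARD('n::{finite,linorder})"
  shows "poly q x = (\<Sum>m\<in>(UNIV :: 'n set). coeff q (index_pred m) * x ^ index_pred m)"
proof -
  have "poly q x = (\<Sum>i<CARD('n). coeff q i * x ^ i)"
    unfolding poly_altdef using assms
    by (intro sum.mono_neutral_left) (auto simp: coeff_eq_0)
  also have "\<dots> = (\<Sum>m\<in>(UNIV :: 'n set). coeff q (index_pred m) * x ^ index_pred m)"
    by (rule sum_index_pred[symmetric])
  finally show ?thesis .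
qed

text \<open>Grouped by the larger index, the factors become the diagonal entries of the triangular
  matrix in \<open>vandermonde_eq_det\<close>.\<close>

lemma vandermonde_alt:
  "vandermonde \<mu> = (\<Prod>l\<in>UNIV. \<Prod>k\<in>{k. k < l}. \<mu> $ l - \<mu> $ k)"
proof -
  have "vandermonde \<mu> = (\<Prod>(l, k)\<in>(SIGMA l:UNIV. {k. k < l}). \<mu> $ l - \<mu> $ k)"
    unfolding vandermonde_def
    by (rule prod.reindex_bij_witness[of _ prod.swap prod.swap]) auto
  then show ?thesis
    by (simp add: prod.Sigma)
qed

text \<open>
  The matrix \<open>T\<close> of powers is turned into a triangular one by passing from the monomials to the
  Newton polynomials of the points \<open>t\<^sub>j\<close>, a unitriangular change of basis.
\<close>

lemma vandermonde_eq_det: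
  fixes t :: "'a::idom ^ 'n::{finite,linorder}"
  shows "vandermonde t = det (\<chi> k l. t $ l ^ index_pred k)"
proof -
  define q where "q k = (\<Prod>j\<in>{j. j < k}. [:- (t $ j), 1:])" for k
  define C :: "'a ^ 'n::{finite,linorder} ^ 'n::{finite,linorder}" where "C = (\<chi> k m. coeff (q k) (index_pred m))"
  define T :: "'a ^ 'n::{finite,linorder} ^ 'n::{finite,linorder}" where "T = (\<chi> k l. t $ l ^ index_pred k)"
  have deg: "degree (q k) = index_pred k" for k
    unfolding q_def by (subst degree_prod_eq_sum_degree) (auto simp: index_pred_def)
  have lead: "lead_coeff (q k) = 1" for k
    unfolding q_def by (subst lead_coeff_prod) simp
  have "(C ** T) $ k $ l = poly (q k) (t $ l)" for k l
    unfolding poly_eq_sum_index_pred[of "q k", where 'n='n, unfolded deg, OF index_pred_less_CARD]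
    by (simp add: matrix_matrix_mult_def C_def T_def)
  then have CT: "(C ** T) $ k $ l = (\<Prod>j\<in>{j. j < k}. t $ l - t $ j)" for k l
    by (simp add: q_def poly_prod)
  have "det C = 1"
    using lead by (subst det_lower_triangular)
      (auto simp: C_def coeff_eq_0 deg index_pred_less_iff intro!: prod.neutral)
  then have "det T = det (C ** T)"
    by (simp add: det_mul)
  \<comment> \<open>For \<open>l < k\<close> the entry of \<open>C ** T\<close> contains the zero
    factor \<open>j = l\<close>, so the matrix is upper triangular.\<close>
  also have "\<dots> = vandermonde t"
    unfolding vandermonde_alt by (subst det_upper_triangular) (auto simp: CT)
  finally show ?thesis
    by (simp add: T_def)
qed

text \<open>Permuting the coordinates permutes the columns of the matrix of powers.\<close>

lemma vandermonde_permute: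
  fixes t :: "'a::idom ^ 'n::{finite,linorder}"
  assumes "p permutes (UNIV :: 'n set)"
  shows "vandermonde (\<chi> i. t $ p i) = of_int (sign p) * vandermonde t"
  using det_permute_columns[OF assms, of "\<chi> k l. t $ l ^ index_pred k"]
  by (simp add: vandermonde_eq_det)

text \<open>Applied with \<open>c = \<i>\<close>, this compares the denominators of the two
  formulas.\<close>

lemma vandermonde_smult:
  fixes \<mu> :: "'a::comm_ring_1 ^ 'n::{finite,linorder}"
  shows "vandermonde (\<chi> k. c * \<mu> $ k) = c ^ card {(k :: 'n, l). k < l} * vandermonde \<mu>"
  unfolding vandermonde_def
  by (simp add: right_diff_distrib[symmetric] case_prod_unfold prod.distrib)

lemma vandermonde_of_real:
  "vandermonde (\<chi> k. of_real (\<mu> $ k)) = of_real (vandermonde \<mu>)"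
  unfolding vandermonde_def by (simp add: case_prod_unfold)

subsection \<open>Lebesgue measure on Cartesian powers of the line\<close>

lemma prod_Basis_cart:
  "(\<Prod>b\<in>Basis. h b) = (\<Prod>i\<in>UNIV. h (axis i (1::real) :: real ^ 'n))"
proof -
  have "(Basis :: (real ^ 'n) set) = (\<lambda>i. axis i 1) ` UNIV"
    by (auto simp: Basis_vec_def)
  moreover have inj: "inj (\<lambda>i. axis i (1::real) :: real ^ 'n)"
    by (auto simp: inj_on_def axis_eq_axis)
  ultimately have "(\<Prod>b\<in>Basis. h b) = prod h ((\<lambda>i. axis i (1::real) :: real ^ 'n) ` UNIV)"
    by simp
  also have "\<dots> = (\<Prod>i\<in>UNIV. h (axis i (1::real) :: real ^ 'n))"
    unfolding prod.reindex[OF inj] o_def ..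
  finally show ?thesis .
qed

lemma box_cart_PiE: "(\<lambda>f. \<chi> i. f i) -` box l u = PiE UNIV (\<lambda>i. {l $ i <..< u $ i :: real})"
  by (auto simp: mem_box_cart PiE_def Pi_def)

lemma borel_measurable_vec_lambda:
  fixes f :: "'a \<Rightarrow> 'n::finite \<Rightarrow> real"
  assumes "\<And>i. (\<lambda>x. f x i) \<in> borel_measurable M"
  shows "(\<lambda>x. \<chi> i. f x i) \<in> borel_measurable M"
  by (subst borel_measurable_euclidean_space) (auto simp: Basis_vec_def inner_axis assms)

lemma measurable_PiM_vec_lambda:
  "(\<lambda>f. \<chi> i. f i) \<in> PiM (UNIV :: 'n::finite set) (\<lambda>_. lborel :: real measure) \<rightarrow>\<^sub>M borel"
  by (rule borel_measurable_vec_lambda) simp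

interpretation lborel_prod: product_sigma_finite "\<lambda>_ :: 'n. lborel :: real measure" ..

text \<open>Both measures agree on boxes, which determine \<open>lborel\<close>. This transports
  Fubini for finite products to vectors.\<close>

lemma lborel_cart_eq_distr_PiM:
  "(lborel :: (real ^ 'n) measure) = distr (PiM UNIV (\<lambda>_. lborel)) borel (\<lambda>f. \<chi> i. f i)"
proof (rule lborel_eqI)
  fix l u :: "real ^ 'n"
  assume le: "\<And>b. b \<in> Basis \<Longrightarrow> l \<bullet> b \<le> u \<bullet> b"
  have le: "l $ i \<le> u $ i" for i
    using le[of "axis i 1"] by (auto simp: Basis_vec_def inner_axis)
  show "emeasure (distr (PiM UNIV (\<lambda>_. lborel)) borel (\<lambda>f. \<chi> i. f i)) (box l u) =
      ennreal (\<Prod>b\<in>Basis. (u - l) \<bullet> b)"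
    using le
    by (simp add: emeasure_distr measurable_PiM_vec_lambda box_cart_PiE space_PiM
        lborel_prod.emeasure_PiM prod_Basis_cart inner_axis prod_ennreal)
qed simp

section \<open>Invariance of Lebesgue measure under permutations of the coordinates\<close>

lemma measurable_permute_cart:
  "(\<lambda>t :: real ^ 'n. \<chi> i. t $ p i) \<in> borel_measurable borel"
  by (rule borel_measurable_vec_lambda) simp

text \<open>The preimage of a box is the box with permuted sides, which has the same volume.\<close>

lemma lborel_distr_permute:
  assumes p: "p permutes (UNIV :: 'n::finite set)"
  shows "distr lborel borel (\<lambda>t :: real ^ 'n. \<chi> i. t $ p i) = lborel"
proof (rule lborel_eqI[symmetric])
  fix l u :: "real ^ 'n"
  assume le: "\<And>b. b \<in> Basis \<Longrightarrow> l \<bullet> b \<le> u \<bullet> b"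
  have le: "l $ i \<le> u $ i" for i
    using le[of "axis i 1"] by (auto simp: Basis_vec_def inner_axis)
  \<comment> \<open>Replacing \<open>i\<close> by \<open>inv p (p i)\<close> expresses every bound
    through \<open>p i\<close>, which runs through all indices.\<close>
  have "(l $ i < t $ p i \<and> t $ p i < u $ i) \<longleftrightarrow>
      (l $ inv p (p i) < t $ p i \<and> t $ p i < u $ inv p (p i))" for t :: "real ^ 'n" and i
    using p by (simp add: permutes_inverses)
  then have *: "(\<lambda>t. \<chi> i. t $ p i) -` box l u = box (\<chi> i. l $ inv p i) (\<chi> i. u $ inv p i)"
    by (auto simp: mem_box_cart) (metis p permutes_inverses(1))+
  have "(\<Prod>i\<in>UNIV. u $ inv p i - l $ inv p i) = (\<Prod>i\<in>UNIV. u $ i - l $ i)"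
    using prod.permute[OF permutes_inv[OF p], of "\<lambda>i. u $ i - l $ i"] by (simp add: o_def)
  then show "emeasure (distr lborel borel (\<lambda>t. \<chi> i. t $ p i)) (box l u) =
      ennreal (\<Prod>b\<in>Basis. (u - l) \<bullet> b)"
    using le by (simp add: emeasure_distr measurable_permute_cart * prod_Basis_cart inner_axis
        emeasure_lborel_box_eq) (auto simp: Basis_vec_def inner_axis)
qed simp

text \<open>Since \<open>T\<close> preserves the Borel measure, preimages of null sets are null, so
  \<open>T\<close> stays measurable and measure preserving after completion.\<close>

lemma
  fixes T :: "'a::euclidean_space \<Rightarrow> 'a"
  assumes T: "T \<in> borel_measurable borel" and distr: "distr lborel borel T = lborel"
  shows lebesgue_measurable_measure_preserving: "T \<in> lebesgue \<rightarrow>\<^sub>M lebesgue"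
    and lebesgue_distr_measure_preserving: "distr lebesgue lebesgue T = lebesgue"
proof -
  have T': "T \<in> lebesgue \<rightarrow>\<^sub>M lborel"
    using T by (simp add: measurable_completion)
  have eq: "distr lebesgue lborel T = lborel"
    using T distr by (simp add: distr_completion cong: distr_cong)
  show "T \<in> lebesgue \<rightarrow>\<^sub>M lebesgue"
    by (rule completion.measurable_completion2[OF T']) (simp add: eq)
  show "distr lebesgue lebesgue T = lebesgue"
    using completion.completion_distr_eq[OF T'] by (simp add: eq)
qed

lemma integral_lebesgue_permute:
  fixes F :: "real ^ 'n \<Rightarrow> 'b::{banach,second_countable_topology}"
  assumes p: "p permutes (UNIV :: 'n::finite set)" and F: "F \<in> borel_measurable lebesgue"
  shows "(\<integral>t. F (\<chi> i. t $ p i) \<partial>lebesgue) = integral\<^sup>L lebesgue F"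
    and "integrable lebesgue (\<lambda>t. F (\<chi> i. t $ p i)) \<longleftrightarrow> integrable lebesgue F"
proof -
  note T = measurable_permute_cart[of p] lborel_distr_permute[OF p]
  note meas = lebesgue_measurable_measure_preserving[OF T]
  note distr = lebesgue_distr_measure_preserving[OF T]
  show "(\<integral>t. F (\<chi> i. t $ p i) \<partial>lebesgue) = integral\<^sup>L lebesgue F"
    using integral_distr[OF meas F] by (simp add: distr)
  show "integrable lebesgue (\<lambda>t. F (\<chi> i. t $ p i)) \<longleftrightarrow> integrable lebesgue F"
    using integrable_distr_eq[OF meas F] by (simp add: distr)
qed

text \<open>The cylinder over a null set of the line is a null set.\<close>

lemma AE_lborel_component:
  assumes "AE u in lborel. Q u"
  shows "AE t in (lborel :: (real ^ 'n) measure). Q (t $ i)"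
proof -
  obtain N where N: "{u. \<not> Q u} \<subseteq> N" "N \<in> sets borel" "emeasure lborel N = 0"
    using assms by (auto elim!: AE_E)
  define B where "B j = (if j = i then N else UNIV)" for j
  \<comment> \<open>The factor at \<open>i\<close> is \<open>0\<close> while any others are
    infinite; in \<open>ennreal\<close> their product is \<open>0\<close>.\<close>
  have "emeasure (PiM UNIV (\<lambda>_. lborel)) (PiE UNIV B) = 0"
    using N by (subst lborel_prod.emeasure_PiM) (auto simp: B_def intro!: prod_zero bexI[of _ i])
  moreover have "(\<lambda>f. \<chi> i. f i) -` {t. t $ i \<in> N} = PiE UNIV B"
    by (auto simp: B_def PiE_def Pi_def)
  moreover have meas: "{t. t $ i \<in> N} \<in> sets borel"
    using measurable_sets[of "\<lambda>t. t $ i" borel borel N] N(2) by (simp add: vimage_def)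
  ultimately have "emeasure lborel {t. t $ i \<in> N} = 0"
    unfolding lborel_cart_eq_distr_PiM
    by (simp add: emeasure_distr measurable_PiM_vec_lambda space_PiM)
  then have "{t. t $ i \<in> N} \<in> null_sets lborel"
    using meas by (auto simp: null_sets_def)
  then show ?thesis
    by (rule AE_I') (use N(1) in auto)
qed

lemma
  fixes f :: "'n::finite \<Rightarrow> real \<Rightarrow> 'b::{real_normed_field,banach,second_countable_topology}"
  assumes f: "\<And>i. integrable lborel (f i)"
  shows integrable_lborel_prod_components: "integrable (lborel :: (real ^ 'n) measure) (\<lambda>t. \<Prod>i\<in>UNIV. f i (t $ i))"
    and integral_lborel_prod_components:
      "(\<integral>t. (\<Prod>i\<in>UNIV. f i (t $ i)) \<partial>(lborel :: (real ^ 'n) measure)) = (\<Prod>i\<in>UNIV. integral\<^sup>L lborel (f i))"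
proof -
  have [measurable]: "f i \<in> borel_measurable borel" for i
    using f[of i] by (auto dest: borel_measurable_integrable)
  have meas: "(\<lambda>t. \<Prod>i\<in>UNIV. f i (t $ i)) \<in> borel_measurable (borel :: (real ^ 'n) measure)"
    by measurable
  show "integrable (lborel :: (real ^ 'n) measure) (\<lambda>t. \<Prod>i\<in>UNIV. f i (t $ i))"
    unfolding lborel_cart_eq_distr_PiM using lborel_prod.product_integrable_prod[of UNIV f] f
    by (subst integrable_distr_eq) (auto simp: measurable_PiM_vec_lambda meas)
  show "(\<integral>t. (\<Prod>i\<in>UNIV. f i (t $ i)) \<partial>(lborel :: (real ^ 'n) measure)) = (\<Prod>i\<in>UNIV. integral\<^sup>L lborel (f i))"
    unfolding lborel_cart_eq_distr_PiM using lborel_prod.product_integral_prod[of UNIV f] f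
    by (subst integral_distr) (auto simp: measurable_PiM_vec_lambda meas)
qed

text \<open>The inner integral, as a function of \<open>t\<close>, ignores coordinate
  \<open>i\<close>. Fubini makes it finite almost everywhere in the other coordinates; a second use
  of Fubini, on the indicator of the set where it is infinite, carries this to the full
  product.\<close>

lemma AE_nn_integral_update:
  fixes F :: "('n::finite \<Rightarrow> real) \<Rightarrow> ennreal"
  assumes F[measurable]: "F \<in> borel_measurable (PiM UNIV (\<lambda>_. lborel))"
    and fin: "(\<integral>\<^sup>+t. F t \<partial>PiM UNIV (\<lambda>_. lborel)) < \<infinity>"
  shows "AE t in PiM UNIV (\<lambda>_. lborel). (\<integral>\<^sup>+u. F (t(i := u)) \<partial>lborel) < \<infinity>"
proof -
  define J where "J = UNIV - {i}"
  have UNIV: "UNIV = insert i J" and J: "finite J" "i \<notin> J"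
    by (auto simp: J_def)
  define h where "h t = (\<integral>\<^sup>+u. F (t(i := u)) \<partial>lborel)" for t
  have [measurable]: "(\<lambda>(t, u). t(i := u)) \<in> PiM UNIV (\<lambda>_. lborel) \<Otimes>\<^sub>M lborel
      \<rightarrow>\<^sub>M PiM UNIV (\<lambda>_. lborel :: real measure)"
  proof (rule measurable_PiM_single')
    show "(\<lambda>x. (case x of (t, u) \<Rightarrow> t(i := u)) j) \<in> PiM UNIV (\<lambda>_. lborel) \<Otimes>\<^sub>M lborel \<rightarrow>\<^sub>M lborel" for j
      by (cases "j = i") (auto simp: case_prod_unfold)
  qed (auto simp: space_PiM)
  have h[measurable]: "h \<in> borel_measurable (PiM UNIV (\<lambda>_. lborel))"
    unfolding h_def by measurable
  have h_upd: "h (t(i := u)) = h t" for t u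
    by (simp add: h_def)
  have [measurable]: "(\<lambda>(t, u). t(i := u)) \<in> PiM J (\<lambda>_. lborel) \<Otimes>\<^sub>M lborel
      \<rightarrow>\<^sub>M PiM UNIV (\<lambda>_. lborel :: real measure)"
    using measurable_add_dim[of i J "\<lambda>_. lborel :: real measure"] by (simp add: UNIV[symmetric])
  have hJ: "h \<in> borel_measurable (PiM J (\<lambda>_. lborel))"
    unfolding h_def by measurable
  have int: "integral\<^sup>N (PiM UNIV (\<lambda>_. lborel)) G =
      (\<integral>\<^sup>+x. (\<integral>\<^sup>+y. G (x(i := y)) \<partial>lborel) \<partial>PiM J (\<lambda>_. lborel))"
    if "G \<in> borel_measurable (PiM UNIV (\<lambda>_. lborel))" for G :: "('n \<Rightarrow> real) \<Rightarrow> ennreal"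
    using lborel_prod.product_nn_integral_insert[OF J, of G] that by (simp add: UNIV[symmetric])
  have "(\<integral>\<^sup>+x. h x \<partial>PiM J (\<lambda>_. lborel)) < \<infinity>"
    using fin by (simp add: int h_def)
  then have "AE x in PiM J (\<lambda>_. lborel). h x \<noteq> \<infinity>"
    using hJ by (intro nn_integral_PInf_AE) auto
  then have "(\<integral>\<^sup>+x. (\<integral>\<^sup>+y. indicator {t. h t = \<infinity>} (x(i := y)) \<partial>lborel) \<partial>PiM J (\<lambda>_. lborel :: real measure)) =
      (\<integral>\<^sup>+x. 0 \<partial>PiM J (\<lambda>_. lborel :: real measure))"
    by (intro nn_integral_cong_AE) (auto simp: h_upd indicator_def)
  then have "(\<integral>\<^sup>+t. indicator {t. h t = \<infinity>} t \<partial>PiM UNIV (\<lambda>_. lborel)) = 0"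
    by (subst int) auto
  then have "AE t in PiM UNIV (\<lambda>_. lborel). indicator {t. h t = \<infinity>} t = (0 :: ennreal)"
    by (subst (asm) nn_integral_0_iff_AE) auto
  then show ?thesis
    by eventually_elim (auto simp: indicator_def h_def less_top split: if_splits)
qed

subsection \<open>Moments of a product density\<close>

lemma vandermonde_nonzero:
  fixes t :: "'a::idom ^ 'n::{finite,linorder}"
  assumes "inj (\<lambda>k. t $ k)"
  shows "vandermonde t \<noteq> 0"
  using assms by (auto simp: vandermonde_def inj_eq)

text \<open>The quotients are the Lagrange basis polynomials for the nodes \<open>t $ i\<close>,
  evaluated at \<open>u\<close>. Cramer's rule produces them, since replacing column
  \<open>i\<close> of the matrix of powers by the powers of \<open>u\<close> gives a Vandermonde
  matrix again.\<close>

lemma power_eq_sum_vandermonde: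
  fixes t :: "real ^ 'n::{finite,linorder}"
  assumes "vandermonde t \<noteq> 0"
  shows "u ^ index_pred (k :: 'n) =
    (\<Sum>i\<in>UNIV. t $ i ^ index_pred k * (vandermonde (\<chi> j. if j = i then u else t $ j) / vandermonde t))"
proof -
  define A :: "real ^ 'n::{finite,linorder} ^ 'n::{finite,linorder}" where "A = (\<chi> k l. t $ l ^ index_pred k)"
  define b :: "real ^ 'n::{finite,linorder}" where "b = (\<chi> k. u ^ index_pred k)"
  have det_A: "det A = vandermonde t"
    by (simp add: A_def vandermonde_eq_det)
  have "det (\<chi> k j. if j = i then b $ k else A $ k $ j) =
      vandermonde (\<chi> j. if j = i then u else t $ j)" for i
    unfolding vandermonde_eq_det
    by (rule arg_cong[where f = det]) (auto simp: vec_eq_iff A_def b_def)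
  then have "A *v (\<chi> i. vandermonde (\<chi> j. if j = i then u else t $ j) / vandermonde t) = b"
    using cramer[of A _ b] assms det_A by simp
  then have "(A *v (\<chi> i. vandermonde (\<chi> j. if j = i then u else t $ j) / vandermonde t)) $ k = b $ k"
    by simp
  then show ?thesis
    by (simp add: matrix_vector_mult_def A_def b_def)
qed

text \<open>The bound \<open>\<bar>v t\<bar> \<le> 1 + (v t)\<^sup>2\<close> dominates the product
  by the sum of the two given integrable functions.\<close>

lemma integrable_mult_if_square:
  fixes G v :: "'a \<Rightarrow> real"
  assumes G: "integrable M G" and G2: "integrable M (\<lambda>t. G t * (v t)\<^sup>2)"
    and nonneg: "\<And>t. 0 \<le> G t" and [measurable]: "v \<in> borel_measurable M"
  shows "integrable M (\<lambda>t. G t * v t)"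
proof (rule Bochner_Integration.integrable_bound)
  note [measurable] = borel_measurable_integrable[OF G]
  show "integrable M (\<lambda>t. G t + G t * (v t)\<^sup>2)"
    using G G2 by simp
  show "(\<lambda>t. G t * v t) \<in> borel_measurable M"
    by measurable
  show "AE t in M. norm (G t * v t) \<le> norm (G t + G t * (v t)\<^sup>2)"
  proof (intro AE_I2)
    fix t
    have "\<bar>v t\<bar> \<le> 1 + (v t)\<^sup>2"
      using zero_le_power2[of "\<bar>v t\<bar> - 1"] zero_le_power2[of "v t"]
      by (simp add: power2_eq_square algebra_simps)
    from mult_left_mono[OF this nonneg]
    show "norm (G t * v t) \<le> norm (G t + G t * (v t)\<^sup>2)"
      using nonneg[of t] by (simp add: abs_mult algebra_simps)
  qed
qed

lemma vandermonde_measurable[measurable]: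
  "(vandermonde :: real ^ 'n::{finite,linorder} \<Rightarrow> real) \<in> borel_measurable borel"
  unfolding vandermonde_def[abs_def] by (auto intro!: borel_measurable_continuous_onI continuous_intros simp: case_prod_unfold)

text \<open>Each equation \<open>t $ k = t $ l\<close> with \<open>k \<noteq> l\<close> cuts out a
  hyperplane, and there are finitely many of them.\<close>

lemma AE_lborel_inj: "AE t in (lborel :: (real ^ 'n) measure). inj (\<lambda>k. t $ k)"
proof -
  have "AE t in (lborel :: (real ^ 'n) measure). t $ k \<noteq> t $ l" if "k \<noteq> l" for k l
  proof -
    have "(axis k 1 - axis l 1 :: real ^ 'n) \<noteq> 0"
      using that by (simp add: axis_eq_axis)
    then have "negligible {t :: real ^ 'n. (axis k 1 - axis l 1) \<bullet> t = 0}"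
      by (intro negligible_hyperplane) auto
    also have "{t :: real ^ 'n. (axis k 1 - axis l 1) \<bullet> t = 0} = {t. t $ k = t $ l}"
      by (auto simp: inner_diff_left inner_axis')
    finally have "{t :: real ^ 'n. t $ k = t $ l} \<in> null_sets lebesgue"
      by (simp add: negligible_iff_null_sets)
    then have "AE t in (lebesgue :: (real ^ 'n) measure). t $ k \<noteq> t $ l"
      by (rule AE_I') auto
    then show ?thesis
      by (simp add: AE_completion_iff)
  qed
  then have "AE t in (lborel :: (real ^ 'n) measure). \<forall>k l. k \<noteq> l \<longrightarrow> t $ k \<noteq> t $ l"
  proof (intro eventually_all_finite)
    show "AE t in (lborel :: (real ^ 'n) measure). k \<noteq> l \<longrightarrow> t $ k \<noteq> t $ l" for k l
      using \<open>k \<noteq> l \<Longrightarrow> AE t in lborel. t $ k \<noteq> t $ l\<close> by (cases "k = l") auto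
  qed
  then show ?thesis
    by eventually_elim (auto simp: inj_def)
qed

text \<open>
  By Fubini, for almost every \<open>t\<close> the function \<open>\<gamma>(u) V(t\<^sub>1, \<dots>, u, \<dots>, t\<^sub>N)\<^sup>2\<close> of \<open>u\<close> is integrable,
  whichever coordinate carries \<open>u\<close>. Fixing one such \<open>t\<close> with distinct coordinates and
  \<open>\<gamma>(t\<^sub>i) > 0\<close>, Cramer's rule writes every \<open>u\<^sup>k\<close> as a combination of these Vandermonde polynomials.
\<close>

lemma integrable_moments_lborel:
  fixes \<gamma> :: "real \<Rightarrow> real"
  assumes \<gamma>[measurable]: "\<gamma> \<in> borel_measurable borel" and nonneg: "\<And>u. 0 \<le> \<gamma> u"
    and int: "integrable lborel
      (\<lambda>t :: real ^ 'n::{finite,linorder}. (\<Prod>i\<in>UNIV. \<gamma> (t $ i)) * (vandermonde t)\<^sup>2)"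
  shows "integrable lborel (\<lambda>u. \<gamma> u * u ^ index_pred (k :: 'n))"
proof (cases "emeasure lborel {u. 0 < \<gamma> u} = 0")
  \<comment> \<open>Here \<open>\<gamma>\<close> vanishes almost everywhere, so there may be no base
    point with positive weights, but the claim is trivial.\<close>
  case True
  have [measurable]: "{u. 0 < \<gamma> u} \<in> sets borel"
    by measurable
  have "AE u in lborel. \<gamma> u = 0"
    using True nonneg by (intro AE_I'[of "{u. 0 < \<gamma> u}"]) (auto simp: null_sets_def less_le)
  then have "AE u in lborel. \<gamma> u * u ^ index_pred k = 0"
    by eventually_elim simp
  then show ?thesis
    by (subst integrable_cong_AE[where g = "\<lambda>_. 0"]) auto
next
  case False
  let ?P = "PiM (UNIV :: 'n set) (\<lambda>_. lborel :: real measure)"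
  note [measurable] = measurable_PiM_vec_lambda
  define F where "F t = (\<Prod>i\<in>UNIV. \<gamma> (t $ i)) * (vandermonde t)\<^sup>2" for t :: "real ^ 'n::{finite,linorder}"
  have F_nonneg: "0 \<le> F t" for t
    by (simp add: F_def prod_nonneg nonneg)
  have [measurable]: "F \<in> borel_measurable borel"
    unfolding F_def[abs_def] by measurable
  have "(\<integral>\<^sup>+t. ennreal (F t) \<partial>lborel) < \<infinity>"
    using int[folded F_def] F_nonneg by (simp add: integrable_iff_bounded)
  then have "(\<integral>\<^sup>+t. ennreal (F (\<chi> i. t i)) \<partial>?P) < \<infinity>"
    by (subst (asm) lborel_cart_eq_distr_PiM) (simp add: nn_integral_distr)
  then have "AE t in ?P. (\<integral>\<^sup>+u. ennreal (F (\<chi> j. (t(i := u)) j)) \<partial>lborel) < \<infinity>" for i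
    by (intro AE_nn_integral_update) measurable
  then have AE_fin: "AE t in ?P. \<forall>i. (\<integral>\<^sup>+u. ennreal (F (\<chi> j. (t(i := u)) j)) \<partial>lborel) < \<infinity>"
    by (rule eventually_all_finite)
  have "AE t in ?P. inj (\<lambda>k. (\<chi> i. t i :: real ^ 'n::{finite,linorder}) $ k)"
    using AE_lborel_inj[where 'n='n] by (subst (asm) lborel_cart_eq_distr_PiM) (rule AE_distrD, measurable)
  then have AE_inj: "AE t in ?P. inj t"
    by simp
  have A: "{u. 0 < \<gamma> u} \<in> sets borel"
    by measurable
  \<comment> \<open>The points with all \<open>\<gamma> (t i)\<close> positive form a set of nonzero
    measure, which cannot lie in the null set where one of the other two properties fails. Hence a
    suitable base point exists.\<close>
  have "emeasure ?P (PiE UNIV (\<lambda>_. {u. 0 < \<gamma> u})) \<noteq> 0"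
    using False A by (subst lborel_prod.emeasure_PiM) auto
  moreover have "emeasure ?P (PiE UNIV (\<lambda>_. {u. 0 < \<gamma> u})) = 0"
    if "AE t in ?P. \<not> (\<forall>i. 0 < \<gamma> (t i))"
  proof -
    have "PiE UNIV (\<lambda>_. {u. 0 < \<gamma> u}) \<in> sets ?P"
      using A by (intro sets_PiM_I_finite) auto
    moreover have "AE t in ?P. t \<notin> PiE UNIV (\<lambda>_. {u. 0 < \<gamma> u})"
      using that by eventually_elim (auto simp: PiE_def)
    ultimately have "PiE UNIV (\<lambda>_. {u. 0 < \<gamma> u}) \<in> null_sets ?P"
      by (rule AE_iff_null_sets[THEN iffD2])
    then show ?thesis
      by auto
  qed
  ultimately have "\<not> (AE t in ?P. \<not> (\<forall>i. 0 < \<gamma> (t i)))"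
    by auto
  moreover have "AE t in ?P. \<not> (\<forall>i. 0 < \<gamma> (t i))"
    if *: "\<nexists>t. (\<forall>i. (\<integral>\<^sup>+u. ennreal (F (\<chi> j. (t(i := u)) j)) \<partial>lborel) < \<infinity>) \<and> inj t \<and> (\<forall>i. 0 < \<gamma> (t i))"
    using AE_fin AE_inj
  proof eventually_elim
    case (elim t)
    then show ?case
      using * by blast
  qed
  ultimately obtain t where t: "\<And>i. (\<integral>\<^sup>+u. ennreal (F (\<chi> j. (t(i := u)) j)) \<partial>lborel) < \<infinity>"
    "inj t" "\<And>i. 0 < \<gamma> (t i)"
    by blast
  define \<tau> :: "real ^ 'n::{finite,linorder}" where "\<tau> = (\<chi> j. t j)"
  define W where "W i u = vandermonde (\<chi> j. if j = i then u else \<tau> $ j)" for i u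
  have [measurable]: "(\<lambda>u. \<chi> j. if j = i then u else \<tau> $ j) \<in> borel_measurable borel" for i
    by (rule borel_measurable_vec_lambda) auto
  have [measurable]: "W i \<in> borel_measurable borel" for i
    unfolding W_def[abs_def] by measurable
  have V: "vandermonde \<tau> \<noteq> 0"
    using t(2) by (intro vandermonde_nonzero) (simp add: \<tau>_def)
  have W2: "integrable lborel (\<lambda>u. \<gamma> u * (W i u)\<^sup>2)" for i
  proof -
    define c where "c = (\<Prod>j\<in>UNIV - {i}. \<gamma> (t j))"
    have "c > 0"
      unfolding c_def using t(3) by (intro prod_pos) auto
    have F_eq: "F (\<chi> j. (t(i := u)) j) = c * (\<gamma> u * (W i u)\<^sup>2)" for u
    proof -
      have "(\<Prod>j\<in>UNIV. \<gamma> ((t(i := u)) j)) = \<gamma> u * c"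
        unfolding c_def by (subst prod.remove[of _ i]) auto
      moreover have "(\<chi> j. (t(i := u)) j) = (\<chi> j. if j = i then u else \<tau> $ j)"
        by (simp add: vec_eq_iff \<tau>_def)
      ultimately show ?thesis
        by (simp add: F_def W_def mult_ac del: fun_upd_apply)
    qed
    have "integrable lborel (\<lambda>u. c * (\<gamma> u * (W i u)\<^sup>2))"
      using t(1)[of i] \<open>c > 0\<close> nonneg unfolding F_eq integrable_iff_bounded by (auto simp: abs_mult)
    then show ?thesis
      using \<open>c > 0\<close> by simp
  qed
  \<comment> \<open>The least index has rank \<open>0\<close>, so there the interpolation identity
    expands the constant \<open>1\<close>. This settles \<open>\<gamma>\<close> itself before the
    higher powers.\<close>
  have "{j. j < Min (UNIV :: 'n set)} = {}"
    by (metis (no_types) Min_le UNIV_I empty_Collect_eq finite leD)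
  then have "index_pred (Min (UNIV :: 'n set)) = 0"
    unfolding index_pred_def by (simp del: Min_gr_iff)
  with power_eq_sum_vandermonde[OF V, of _ "Min UNIV"]
  have one: "1 = (\<Sum>i\<in>UNIV. W i u / vandermonde \<tau>)" for u
    by (simp add: W_def)
  have "integrable lborel \<gamma>"
  proof (rule Bochner_Integration.integrable_bound)
    show "integrable lborel (\<lambda>u. CARD('n) / (vandermonde \<tau>)\<^sup>2 * (\<Sum>i\<in>UNIV. \<gamma> u * (W i u)\<^sup>2))"
      using W2 by (intro integrable_mult_right Bochner_Integration.integrable_sum) auto
    show "AE u in lborel. norm (\<gamma> u) \<le> norm (CARD('n) / (vandermonde \<tau>)\<^sup>2 * (\<Sum>i\<in>UNIV. \<gamma> u * (W i u)\<^sup>2))"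
    proof (intro AE_I2)
      fix u
      have "1 = (\<Sum>i\<in>UNIV. W i u / vandermonde \<tau>)\<^sup>2"
        using one[of u] by simp
      \<comment> \<open>This is the Cauchy-Schwarz inequality against the constant vector
        \<open>1\<close>.\<close>
      also have "\<dots> \<le> CARD('n) * (\<Sum>i\<in>UNIV. (W i u / vandermonde \<tau>)\<^sup>2)"
        using sum_squared_le_sum_of_squares[of "\<lambda>i. W i u / vandermonde \<tau>" UNIV] by (simp add: mult.commute)
      finally have "\<gamma> u * 1 \<le> \<gamma> u * (CARD('n) * (\<Sum>i\<in>UNIV. (W i u / vandermonde \<tau>)\<^sup>2))"
        using nonneg by (intro mult_left_mono) auto
      also have "\<dots> = CARD('n) / (vandermonde \<tau>)\<^sup>2 * (\<Sum>i\<in>UNIV. \<gamma> u * (W i u)\<^sup>2)"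
        by (simp add: power_divide sum_divide_distrib[symmetric] sum_distrib_left[symmetric])
      finally show "norm (\<gamma> u) \<le> norm (CARD('n) / (vandermonde \<tau>)\<^sup>2 * (\<Sum>i\<in>UNIV. \<gamma> u * (W i u)\<^sup>2))"
        using nonneg[of u] unfolding real_norm_def by linarith
    qed
  qed simp
  have W1: "integrable lborel (\<lambda>u. \<gamma> u * W i u)" for i
    using \<open>integrable lborel \<gamma>\<close> W2 nonneg by (rule integrable_mult_if_square) measurable
  have "integrable lborel (\<lambda>u. \<Sum>i\<in>UNIV. (\<tau> $ i ^ index_pred k / vandermonde \<tau>) * (\<gamma> u * W i u))"
    using W1 by (intro Bochner_Integration.integrable_sum integrable_mult_right) auto
  also have "(\<lambda>u. \<Sum>i\<in>UNIV. (\<tau> $ i ^ index_pred k / vandermonde \<tau>) * (\<gamma> u * W i u)) =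
      (\<lambda>u. \<gamma> u * u ^ index_pred k)"
    by (subst power_eq_sum_vandermonde[OF V]) (simp add: W_def sum_distrib_left mult_ac)
  finally show ?thesis .
qed

subsection \<open>Moments of a density with smooth Fourier transform\<close>

text \<open>The left side equals \<open>2 * \<bar>sin (x / 2)\<bar>\<close>.\<close>

lemma norm_exp_i_minus_1_le: "norm (exp (\<i> * of_real x) - 1) \<le> \<bar>x\<bar>"
  using abs_sin_x_le_abs_x[of "x / 2"] by (simp add: dist_exp_i_1)

lemma has_vector_derivative_at_0_iff:
  fixes f :: "real \<Rightarrow> 'a::real_normed_vector"
  shows "(f has_vector_derivative D) (at 0) \<longleftrightarrow> ((\<lambda>h. (f h - f 0) /\<^sub>R h) \<longlongrightarrow> D) (at 0)"
proof -
  have eq: "norm (f h - f 0 - h *\<^sub>R D) / \<bar>h\<bar> = norm ((f h - f 0) /\<^sub>R h - D)" if "h \<noteq> 0" for h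
  proof -
    have "(f h - f 0) /\<^sub>R h - D = (f h - f 0 - h *\<^sub>R D) /\<^sub>R h"
      using that by (simp add: scaleR_right_diff_distrib)
    then show ?thesis
      by (simp add: divide_inverse mult.commute)
  qed
  have "(f has_vector_derivative D) (at 0) \<longleftrightarrow> ((\<lambda>h. norm (f h - f 0 - h *\<^sub>R D) / \<bar>h\<bar>) \<longlongrightarrow> 0) (at 0)"
    by (simp add: has_vector_derivative_def has_derivative_at bounded_linear_scaleR_left)
  also have "\<dots> \<longleftrightarrow> ((\<lambda>h. norm ((f h - f 0) /\<^sub>R h - D)) \<longlongrightarrow> 0) (at 0)"
    by (rule Lim_cong_within) (auto simp: eq)
  also have "\<dots> \<longleftrightarrow> ((\<lambda>h. (f h - f 0) /\<^sub>R h) \<longlongrightarrow> D) (at 0)"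
    unfolding tendsto_norm_zero_iff by (rule Lim_null[symmetric])
  finally show ?thesis .
qed

text \<open>The difference quotients are bounded by the norm of \<open>a F\<close>, so dominated
  convergence applies along every sequence. The derivative at \<open>0\<close> also covers other
  base points, whose exponential can be absorbed into \<open>F\<close>.\<close>

lemma has_vector_derivative_integral_iexp:
  fixes F :: "'a \<Rightarrow> complex" and a :: "'a \<Rightarrow> real"
  assumes [measurable]: "a \<in> borel_measurable M"
    and F: "integrable M F" and aF: "integrable M (\<lambda>t. of_real (a t) * F t)"
  shows "((\<lambda>h. \<integral>t. F t * exp (\<i> * of_real (h * a t)) \<partial>M) has_vector_derivative
    (\<integral>t. \<i> * of_real (a t) * F t \<partial>M)) (at 0)"
proof -
  note [measurable] = borel_measurable_integrable[OF F]
  have int: "integrable M (\<lambda>t. F t * exp (\<i> * of_real (h * a t)))" for h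
    by (rule Bochner_Integration.integrable_bound[OF F])
       (auto simp: norm_mult norm_exp_i_times simp del: of_real_mult)
  define q where "q h t = F t * (exp (\<i> * of_real (h * a t)) - 1) /\<^sub>R h" for h t
  have q_int: "(\<integral>t. q h t \<partial>M) = ((\<integral>t. F t * exp (\<i> * of_real (h * a t)) \<partial>M) - (\<integral>t. F t \<partial>M)) /\<^sub>R h" for h
    unfolding q_def using int[of h] F
    by (simp add: right_diff_distrib)
  have "((\<lambda>h. \<integral>t. q h t \<partial>M) \<longlongrightarrow> (\<integral>t. \<i> * of_real (a t) * F t \<partial>M)) (at 0)"
    unfolding tendsto_at_iff_sequentially comp_def
  proof (intro allI impI)
    fix X :: "nat \<Rightarrow> real" assume X: "\<forall>i. X i \<in> UNIV - {0}" "X \<longlonglongrightarrow> 0"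
    show "(\<lambda>n. \<integral>t. q (X n) t \<partial>M) \<longlonglongrightarrow> (\<integral>t. \<i> * of_real (a t) * F t \<partial>M)"
    proof (rule integral_dominated_convergence)
      show "integrable M (\<lambda>t. norm (of_real (a t) * F t))"
        using aF by (rule integrable_norm)
      show "AE t in M. (\<lambda>n. q (X n) t) \<longlonglongrightarrow> \<i> * of_real (a t) * F t"
      proof (intro AE_I2)
        fix t
        have "((\<lambda>h. exp (\<i> * of_real (h * a t))) has_vector_derivative \<i> * of_real (a t)) (at 0)"
          using has_vector_derivative_real_field[of "\<lambda>z. exp (\<i> * (z * of_real (a t)))" "\<i> * of_real (a t)" 0 UNIV]
          by (force intro!: derivative_eq_intros)
        then have "((\<lambda>h. (exp (\<i> * of_real (h * a t)) - 1) /\<^sub>R h) \<longlongrightarrow> \<i> * of_real (a t)) (at 0)"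
          by (simp add: has_vector_derivative_at_0_iff)
        then have "(\<lambda>n. (exp (\<i> * of_real (X n * a t)) - 1) /\<^sub>R X n) \<longlonglongrightarrow> \<i> * of_real (a t)"
          using X unfolding tendsto_at_iff_sequentially comp_def by blast
        from tendsto_mult[OF tendsto_const this, of "F t"]
        show "(\<lambda>n. q (X n) t) \<longlonglongrightarrow> \<i> * of_real (a t) * F t"
          by (simp add: q_def mult_ac)
      qed
      show "AE t in M. norm (q (X n) t) \<le> norm (of_real (a t) * F t)" for n
      proof (intro AE_I2)
        fix t
        have "norm (exp (\<i> * of_real (X n * a t)) - 1) \<le> \<bar>X n\<bar> * \<bar>a t\<bar>"
          using norm_exp_i_minus_1_le[of "X n * a t"] by (simp add: abs_mult)
        then have "norm (exp (\<i> * of_real (X n * a t)) - 1) / \<bar>X n\<bar> \<le> \<bar>a t\<bar>"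
          using X by (auto simp: field_simps)
        from mult_right_mono[OF this, of "norm (F t)"]
        show "norm (q (X n) t) \<le> norm (of_real (a t) * F t)"
          by (simp add: q_def norm_mult divide_inverse mult_ac)
      qed
    qed (auto simp: q_def)
  qed
  then show ?thesis
    by (simp add: has_vector_derivative_at_0_iff q_int)
qed

text \<open>
  Bounded second difference quotients at \<open>0\<close> bound the second moment from above, by Fatou's lemma.
\<close>

lemma integrable_second_moment:
  fixes G a :: "'a \<Rightarrow> real"
  assumes [measurable]: "a \<in> borel_measurable M"
    and G: "integrable M G" and nonneg: "\<And>t. 0 \<le> G t"
    and d1: "\<And>h. ((\<lambda>h. \<integral>t. of_real (G t) * exp (\<i> * of_real (h * a t)) \<partial>M) has_vector_derivative \<phi>' h) (at h)"
    and d2: "(\<phi>' has_vector_derivative L) (at 0)"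
  shows "integrable M (\<lambda>t. G t * (a t)\<^sup>2)"
proof -
  note [measurable] = borel_measurable_integrable[OF G]
  have int_cos: "integrable M (\<lambda>t. G t * cos (h * a t))" for h
    by (rule Bochner_Integration.integrable_bound[OF G]) (auto simp: abs_mult mult_left_le)
  have int_exp: "integrable M (\<lambda>t. of_real (G t) * exp (\<i> * of_real (h * a t)))" for h
    by (rule Bochner_Integration.integrable_bound[OF G])
       (auto simp: norm_mult norm_exp_i_times simp del: of_real_mult)
  define r where "r h = (\<integral>t. G t * cos (h * a t) \<partial>M)" for h
  define d where "d h = Re (\<phi>' h)" for h
  have r_eq: "r h = Re (\<integral>t. of_real (G t) * exp (\<i> * of_real (h * a t)) \<partial>M)" for h
    unfolding r_def using integral_Re[OF int_exp[of h]] by (simp add: Re_exp)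
  have r': "(r has_real_derivative d h) (at h)" for h
    unfolding r_eq[abs_def] d_def has_real_derivative_iff_has_vector_derivative
    using d1[of h] by (rule bounded_linear.has_vector_derivative[OF bounded_linear_Re])
  have d': "(d has_real_derivative Re L) (at 0)"
    unfolding d_def[abs_def] has_real_derivative_iff_has_vector_derivative
    using d2 by (rule bounded_linear.has_vector_derivative[OF bounded_linear_Re])
  \<comment> \<open>The real part \<open>r\<close> is even, so its derivative vanishes at
    \<open>0\<close>, and its second derivative there is the limit of
    \<open>d h / h\<close>.\<close>
  have even: "r (- h) = r h" for h
    by (simp add: r_def)
  have "((\<lambda>h. r (- h)) has_real_derivative - d 0) (at 0)"
    using DERIV_mirror[of r "d 0" 0] r'[of 0] unfolding minus_zero by blast
  from DERIV_unique[OF r'[of 0] this[unfolded even]] have "d 0 = 0"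
    by linarith
  \<comment> \<open>Adding \<open>1\<close> makes \<open>D\<close> positive and strictly larger than
    the limit of the absolute quotients.\<close>
  define D where "D = \<bar>Re L\<bar> + 1"
  have "((\<lambda>h. d h / h) \<longlongrightarrow> Re L) (at 0)"
    using d' \<open>d 0 = 0\<close> by (simp add: DERIV_def)
  then have "((\<lambda>h. \<bar>d h / h\<bar>) \<longlongrightarrow> \<bar>Re L\<bar>) (at 0)"
    by (rule tendsto_rabs)
  then have "eventually (\<lambda>h. \<bar>d h / h\<bar> < D) (at 0)"
    by (rule order_tendstoD) (simp add: D_def)
  then obtain \<delta> where \<delta>: "\<delta> > 0" "\<And>h. h \<noteq> 0 \<Longrightarrow> \<bar>h\<bar> < \<delta> \<Longrightarrow> \<bar>d h / h\<bar> < D"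
    by (auto simp: eventually_at dist_real_def)
  have bound: "(r 0 - r h) / h\<^sup>2 \<le> D" if h: "0 < h" "h < \<delta>" for h
  proof -
    obtain z where z: "0 < z" "z < h" "r h - r 0 = (h - 0) * d z"
      using MVT2[of 0 h r d] r' h by blast
    have "\<bar>d z\<bar> \<le> D * z"
      using \<delta>(2)[of z] z h by (simp add: abs_divide field_simps)
    also have "\<dots> \<le> D * h"
      using z by (intro mult_left_mono) (auto simp: D_def)
    finally have "h * (- d z) \<le> h * (D * h)"
      using h by (intro mult_left_mono) auto
    then have "r 0 - r h \<le> D * h\<^sup>2"
      using z(3) by (simp add: power2_eq_square mult_ac)
    then show ?thesis
      using h by (simp add: divide_le_eq)
  qed
  \<comment> \<open>The summand \<open>2\<close> keeps \<open>X n\<close> strictly below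
    \<open>\<delta>\<close>, even for \<open>n = 0\<close>.\<close>
  define X where "X n = \<delta> / (real n + 2)" for n
  have X: "0 < X n" "X n < \<delta>" for n
    using \<delta>(1) by (auto simp: X_def field_simps add_pos_nonneg)
  have X_lim: "X \<longlonglongrightarrow> 0"
    unfolding X_def by (intro real_tendsto_divide_at_top[OF tendsto_const]
      filterlim_at_top_mono[OF filterlim_real_sequentially]) auto
  have "X n \<noteq> 0" for n
    using X(1)[of n] by simp
  then have X_at: "filterlim X (at 0) sequentially"
    using X_lim by (intro filterlim_atI) auto
  define u where "u n t = ennreal (G t * (1 - cos (X n * a t)) / (X n)\<^sup>2)" for n t
  have u_int: "integral\<^sup>N M (u n) \<le> ennreal D" for n
  proof -
    have "integral\<^sup>N M (u n) = ennreal (\<integral>t. G t * (1 - cos (X n * a t)) / (X n)\<^sup>2 \<partial>M)"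
      unfolding u_def
    proof (rule nn_integral_eq_integral)
      show "integrable M (\<lambda>t. G t * (1 - cos (X n * a t)) / (X n)\<^sup>2)"
        using int_cos[of "X n"] G by (simp add: right_diff_distrib)
    qed (simp add: nonneg)
    also have "(\<integral>t. G t * (1 - cos (X n * a t)) / (X n)\<^sup>2 \<partial>M) = (r 0 - r (X n)) / (X n)\<^sup>2"
      using int_cos[of "X n"] G by (simp add: r_def right_diff_distrib)
    also have "\<dots> \<le> D"
      using X by (intro bound)
    finally show ?thesis
      by (simp add: ennreal_leI)
  qed
  have u_lim: "(\<lambda>n. u n t) \<longlonglongrightarrow> ennreal (G t * (a t)\<^sup>2 / 2)" for t
  proof -
    \<comment> \<open>With \<open>1 - cos x = 2 * (sin (x / 2))\<^sup>2\<close>, a first-order limit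
      suffices.\<close>
    have "((\<lambda>h. sin (h * a t / 2)) has_real_derivative a t / 2) (at 0)"
      by (auto intro!: derivative_eq_intros)
    then have "((\<lambda>h. sin (h * a t / 2) / h) \<longlongrightarrow> a t / 2) (at 0)"
      by (simp add: DERIV_def)
    then have "(\<lambda>n. sin (X n * a t / 2) / X n) \<longlonglongrightarrow> a t / 2"
      using X_at by (rule filterlim_compose)
    then have "(\<lambda>n. G t * (2 * (sin (X n * a t / 2) / X n)\<^sup>2)) \<longlonglongrightarrow> G t * (2 * (a t / 2)\<^sup>2)"
      by (intro tendsto_mult_left tendsto_power)
  moreover have "G t * (2 * (sin (X n * a t / 2) / X n)\<^sup>2) = G t * (1 - cos (X n * a t)) / (X n)\<^sup>2" for n
      using cos_double_sin[of "X n * a t / 2"] by (simp add: power_divide)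
    moreover have "G t * (2 * (a t / 2)\<^sup>2) = G t * (a t)\<^sup>2 / 2"
      by (simp add: power_divide)
    ultimately have "(\<lambda>n. G t * (1 - cos (X n * a t)) / (X n)\<^sup>2) \<longlonglongrightarrow> G t * (a t)\<^sup>2 / 2"
      by (simp only:)
    then show ?thesis
      unfolding u_def by (rule tendsto_ennrealI)
  qed
  have "(\<integral>\<^sup>+t. ennreal (G t * (a t)\<^sup>2 / 2) \<partial>M) = (\<integral>\<^sup>+t. liminf (\<lambda>n. u n t) \<partial>M)"
    by (intro nn_integral_cong lim_imp_Liminf[symmetric] u_lim) simp
  also have "\<dots> \<le> liminf (\<lambda>n. integral\<^sup>N M (u n))"
    by (rule nn_integral_liminf) (simp add: u_def)
  also have "\<dots> \<le> ennreal D"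
    by (rule Liminf_le) (auto simp: u_int)
  finally have "(\<integral>\<^sup>+t. ennreal (G t * (a t)\<^sup>2 / 2) \<partial>M) < \<infinity>"
    by (rule le_less_trans) simp
  then have "integrable M (\<lambda>t. G t * (a t)\<^sup>2 / 2)"
    using nonneg by (intro integrableI_bounded) auto
  from integrable_mult_right[OF this, of 2] show ?thesis
    by simp
qed

section \<open>Derivatives of the Fourier transform and growth bounds\<close>

text \<open>Complex \<open>F\<close> are allowed so that, where the integrals exist, partial
  derivatives are again transforms: they multiply \<open>F\<close> by
  \<open>\<i> * t $ j\<close>.\<close>

definition iexp_transform :: "(real ^ 'n \<Rightarrow> complex) \<Rightarrow> real ^ 'n \<Rightarrow> complex" where
  "iexp_transform F s = (\<integral>t. F t * exp (\<i> * of_real (s \<bullet> t)) \<partial>lebesgue)"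

lemma inverse_fourier_eq: "inverse_fourier g = iexp_transform (\<lambda>t. of_real (g t))"
  by (simp add: inverse_fourier_def iexp_transform_def fun_eq_iff)

lemma lebesgue_measurable_component[measurable]: "(\<lambda>t :: real ^ 'n. t $ j) \<in> borel_measurable lebesgue"
  by (rule measurable_completion) simp

lemma lebesgue_measurable_inner[measurable]: "(\<lambda>t :: real ^ 'n. s \<bullet> t) \<in> borel_measurable lebesgue"
  by (rule measurable_completion) simp

lemma integrable_mult_iexp:
  assumes F: "integrable lebesgue F"
  shows "integrable lebesgue (\<lambda>t :: real ^ 'n. F t * exp (\<i> * of_real (s \<bullet> t)))"
proof -
  note [measurable] = borel_measurable_integrable[OF F]
  show ?thesis
    by (rule Bochner_Integration.integrable_bound[OF F]) (auto simp: norm_mult norm_exp_i_times)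
qed

text \<open>Moving \<open>s\<close> by \<open>h\<close> along the axis \<open>j\<close> multiplies
  the integrand by \<open>exp (\<i> * h * t $ j)\<close>; the exponential at \<open>s\<close> itself
  is kept in the integrable factor.\<close>

lemma partial_deriv_iexp_transform:
  assumes F: "integrable lebesgue F" and jF: "integrable lebesgue (\<lambda>t. of_real (t $ j) * F t)"
  shows "partial_deriv j (iexp_transform F) = iexp_transform (\<lambda>t. \<i> * of_real (t $ j) * F t)"
proof
  fix s
  have "integrable lebesgue (\<lambda>t. of_real (t $ j) * (F t * exp (\<i> * of_real (s \<bullet> t))))"
    using integrable_mult_iexp[OF jF, of s] by (simp add: mult.assoc)
  from has_vector_derivative_integral_iexp[OF lebesgue_measurable_component integrable_mult_iexp[OF F] this]
  show "partial_deriv j (iexp_transform F) s = iexp_transform (\<lambda>t. \<i> * of_real (t $ j) * F t) s"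
    unfolding partial_deriv_def iexp_transform_def
    by (intro vector_derivative_at)
       (simp add: inner_add_left inner_axis' distrib_left exp_add mult_ac)
qed

text \<open>The derivative along the axis and the partial derivative are both the Frechet derivative
  applied to \<open>axis j 1\<close>. This supplies the one-variable derivatives that
  \<open>integrable_second_moment\<close> asks for.\<close>

lemma has_vector_derivative_partial_deriv:
  assumes "\<And>s. F differentiable (at s)"
  shows "((\<lambda>h. F (h *\<^sub>R axis j 1)) has_vector_derivative partial_deriv j F (h *\<^sub>R axis j 1)) (at h)"
proof -
  obtain D where D: "(F has_derivative D) (at (h *\<^sub>R axis j 1))"
    using assms by (auto simp: differentiable_def)
  interpret D: bounded_linear D
    using D by (rule has_derivative_bounded_linear)
  have "((\<lambda>k. F (h *\<^sub>R axis j 1 + k *\<^sub>R axis j 1)) has_derivative (\<lambda>k. D (k *\<^sub>R axis j 1))) (at 0)"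
    by (rule has_derivative_compose[of _ _ _ _ F]) (use D in \<open>auto intro!: derivative_eq_intros\<close>)
  then have "((\<lambda>k. F (h *\<^sub>R axis j 1 + k *\<^sub>R axis j 1)) has_vector_derivative D (axis j 1)) (at 0)"
    by (simp add: has_vector_derivative_def D.scaleR)
  then have "partial_deriv j F (h *\<^sub>R axis j 1) = D (axis j 1)"
    unfolding partial_deriv_def by (rule vector_derivative_at)
  moreover have "((\<lambda>k. F (k *\<^sub>R axis j 1)) has_derivative (\<lambda>k. D (k *\<^sub>R axis j 1))) (at h)"
    by (rule has_derivative_compose[of _ _ _ _ F]) (use D in \<open>auto intro!: derivative_eq_intros\<close>)
  ultimately show ?thesis
    by (simp add: has_vector_derivative_def D.scaleR)
qed

lemma smooth_differentiable: "smooth F \<Longrightarrow> F differentiable (at s)"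
  unfolding smooth_def by (metis C_order.simps(2))

lemma smooth_partial_deriv: "smooth F \<Longrightarrow> smooth (partial_deriv j F)"
  unfolding smooth_def by (metis C_order.simps(2))

text \<open>The induction takes two derivatives at a time: even powers keep the density nonnegative,
  so \<open>integrable_second_moment\<close> applies again, and the twice differentiated transform
  is smooth. The sign \<open>(-1) ^ m\<close> collects the factors
  \<open>\<i> * \<i>\<close>.\<close>

lemma even_moments_smooth_inverse_fourier:
  fixes g :: "real ^ 'n \<Rightarrow> real"
  assumes nonneg: "\<And>t. g t \<ge> 0" and g: "integrable lebesgue g" and smooth: "smooth (inverse_fourier g)"
  shows "integrable lebesgue (\<lambda>t. g t * (t $ j) ^ (2 * m)) \<and>
    smooth (iexp_transform (\<lambda>t. (-1) ^ m * of_real (g t * (t $ j) ^ (2 * m))))"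
proof (induction m)
  case 0
  then show ?case
    using g smooth by (simp add: inverse_fourier_eq)
next
  case (Suc m)
  define G where "G t = g t * (t $ j) ^ (2 * m)" for t
  define F where "F = iexp_transform (\<lambda>t. (-1) ^ m * of_real (G t))"
  have G: "integrable lebesgue G" and F: "smooth F"
    using Suc by (simp_all only: G_def[abs_def] F_def)
  have G_nonneg: "0 \<le> G t" for t
    by (simp add: G_def nonneg)
  note [measurable] = borel_measurable_integrable[OF G]
  \<comment> \<open>Multiplication by \<open>(-1) ^ m\<close> undoes the sign stored in
    \<open>F\<close> and leaves the transform of the nonnegative \<open>G\<close> along the
    axis.\<close>
  have line: "(\<integral>t. of_real (G t) * exp (\<i> * of_real (h * t $ j)) \<partial>lebesgue) = (-1) ^ m * F (h *\<^sub>R axis j 1)" for h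
    by (simp add: F_def iexp_transform_def inner_axis' mult.assoc flip: power_mult_distrib)
  have "integrable lebesgue (\<lambda>t. G t * (t $ j)\<^sup>2)"
  proof (rule integrable_second_moment[OF lebesgue_measurable_component G G_nonneg])
    show "((\<lambda>h. \<integral>t. of_real (G t) * exp (\<i> * of_real (h * t $ j)) \<partial>lebesgue) has_vector_derivative
        (-1) ^ m * partial_deriv j F (h *\<^sub>R axis j 1)) (at h)" for h
      unfolding line by (intro has_vector_derivative_mult_right has_vector_derivative_partial_deriv
        smooth_differentiable F)
    show "((\<lambda>h. (-1) ^ m * partial_deriv j F (h *\<^sub>R axis j 1)) has_vector_derivative
        (-1) ^ m * partial_deriv j (partial_deriv j F) (0 *\<^sub>R axis j 1)) (at 0)"
      by (intro has_vector_derivative_mult_right has_vector_derivative_partial_deriv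
        smooth_differentiable smooth_partial_deriv F)
  qed
  note G2 = this
  \<comment> \<open>The first of the two derivatives needs the odd moment between the two even
    ones.\<close>
  have G1: "integrable lebesgue (\<lambda>t. G t * t $ j)"
    by (rule integrable_mult_if_square[OF G G2 G_nonneg]) measurable
  have G': "integrable lebesgue (\<lambda>t. (-1) ^ m * complex_of_real (G t))"
    "integrable lebesgue (\<lambda>t. of_real (t $ j) * ((-1) ^ m * complex_of_real (G t)))"
    "integrable lebesgue (\<lambda>t. of_real (t $ j) * (\<i> * of_real (t $ j) * ((-1) ^ m * complex_of_real (G t))))"
    using integrable_mult_right[OF integrable_of_real[OF G], of "(-1 :: complex) ^ m"]
      integrable_mult_right[OF integrable_of_real[OF G1], of "(-1 :: complex) ^ m"]
      integrable_mult_right[OF integrable_of_real[OF G2], of "(-1) ^ m * \<i>"]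
    by (simp_all add: mult_ac power2_eq_square)
  have G'': "integrable lebesgue (\<lambda>t. \<i> * of_real (t $ j) * ((-1) ^ m * complex_of_real (G t)))"
    using integrable_mult_right[OF G'(2), of \<i>] by (simp add: mult.assoc)
  have "partial_deriv j (partial_deriv j F) =
      iexp_transform (\<lambda>t. \<i> * of_real (t $ j) * (\<i> * of_real (t $ j) * ((-1) ^ m * of_real (G t))))"
    unfolding F_def using G' G'' by (simp add: partial_deriv_iexp_transform)
  also have "(\<lambda>t. \<i> * complex_of_real (t $ j) * (\<i> * of_real (t $ j) * ((-1) ^ m * of_real (G t)))) =
      (\<lambda>t. (-1) ^ Suc m * of_real (g t * (t $ j) ^ (2 * Suc m)))"
  proof
    fix t :: "real ^ 'n"
    have "\<i> * complex_of_real (t $ j) * (\<i> * of_real (t $ j) * ((-1) ^ m * of_real (G t))) =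
        (\<i> * \<i>) * ((-1) ^ m * of_real (G t * (t $ j)\<^sup>2))"
      by (simp add: power2_eq_square mult_ac)
    then show "\<i> * complex_of_real (t $ j) * (\<i> * of_real (t $ j) * ((-1) ^ m * of_real (G t))) =
        (-1) ^ Suc m * of_real (g t * (t $ j) ^ (2 * Suc m))"
      by (simp add: G_def power2_eq_square mult_ac)
  qed
  finally show ?case
    using smooth_partial_deriv[OF smooth_partial_deriv[OF F, of j], of j] G2
    by (simp add: G_def power2_eq_square mult_ac)
qed

text \<open>The norm is at most \<open>CARD('n)\<close> times the largest absolute coordinate, whose
  even power is one of the summands.\<close>

lemma power_norm_le_sum:
  fixes t :: "real ^ 'n"
  shows "(1 + norm t) ^ m \<le> (2 * real CARD('n)) ^ (2 * m) * (1 + (\<Sum>j\<in>UNIV. (t $ j) ^ (2 * m)))"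
proof -
  define b where "b = Max (range (\<lambda>j. \<bar>t $ j\<bar>))"
  have le_b: "\<bar>t $ j\<bar> \<le> b" for j
    unfolding b_def by (intro Max_ge) auto
  have "b \<in> range (\<lambda>j. \<bar>t $ j\<bar>)"
    unfolding b_def by (intro Max_in) auto
  then obtain k where k: "b = \<bar>t $ k\<bar>"
    by auto
  \<comment> \<open>The maximum with \<open>1\<close> lets the \<open>1\<close> in
    \<open>1 + norm t\<close> be absorbed into a multiple of \<open>c\<close>.\<close>
  define c where "c = max 1 b"
  have N: "1 \<le> real CARD('n)"
    by (simp add: Suc_leI)
  have "norm t \<le> (\<Sum>j\<in>UNIV. \<bar>t $ j\<bar>)"
    by (rule norm_le_l1_cart)
  also have "\<dots> \<le> (\<Sum>j\<in>(UNIV :: 'n set). c)"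
    using le_b by (intro sum_mono) (auto simp: c_def le_max_iff_disj)
  finally have "1 + norm t \<le> 1 * 1 + CARD('n) * c"
    by simp
  also have "\<dots> \<le> CARD('n) * c + CARD('n) * c"
    using N by (intro add_mono mult_mono) (auto simp: c_def)
  finally have *: "1 + norm t \<le> 2 * CARD('n) * c"
    by (simp add: mult_ac)
  \<comment> \<open>The base is at least \<open>1\<close>, so the exponent may be doubled; even
    powers need no absolute values.\<close>
  have "(1 + norm t) ^ m \<le> (1 + norm t) ^ (2 * m)"
    by (intro power_increasing) auto
  also have "\<dots> \<le> (2 * CARD('n) * c) ^ (2 * m)"
    using * by (intro power_mono) auto
  also have "\<dots> = (2 * CARD('n)) ^ (2 * m) * c ^ (2 * m)"
    by (simp add: power_mult_distrib)
  also have "c ^ (2 * m) \<le> 1 + (\<Sum>j\<in>UNIV. (t $ j) ^ (2 * m))"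
  proof (cases "b \<le> 1")
    case True
    then show ?thesis
      by (simp add: c_def max_def sum_nonneg)
  next
    case False
    then have "c ^ (2 * m) = (t $ k) ^ (2 * m)"
      by (simp add: c_def max_def k power_even_abs)
    also have "\<dots> \<le> (\<Sum>j\<in>UNIV. (t $ j) ^ (2 * m))"
      by (rule member_le_sum) auto
    finally show ?thesis
      by simp
  qed
  finally show ?thesis
    by (simp add: mult_left_mono)
qed

text \<open>The product is dominated by a multiple of \<open>g\<close> plus its even coordinate
  moments, which are finite by smoothness of the transform.\<close>

lemma integrable_poly_growth_smooth:
  fixes g :: "real ^ 'n \<Rightarrow> real" and w :: "real ^ 'n \<Rightarrow> complex"
  assumes nonneg: "\<And>t. g t \<ge> 0" and g: "integrable lebesgue g" and smooth: "smooth (inverse_fourier g)"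
    and [measurable]: "w \<in> borel_measurable lebesgue" and w: "\<And>t. norm (w t) \<le> C * (1 + norm t) ^ m"
  shows "integrable lebesgue (\<lambda>t. w t * of_real (g t))"
proof (rule Bochner_Integration.integrable_bound)
  define B where "B = (2 * real CARD('n)) ^ (2 * m)"
  note [measurable] = borel_measurable_integrable[OF g]
  have "0 \<le> norm (w 0)"
    by simp
  also have "\<dots> \<le> C"
    using w[of 0] by simp
  finally have C: "0 \<le> C" .
  show "integrable lebesgue (\<lambda>t. C * B * (g t + (\<Sum>j\<in>UNIV. g t * (t $ j) ^ (2 * m))))"
    using g even_moments_smooth_inverse_fourier[OF nonneg g smooth] by auto
  show "(\<lambda>t. w t * of_real (g t)) \<in> borel_measurable lebesgue"
    by measurable
  show "AE t in lebesgue. norm (w t * complex_of_real (g t)) \<le>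
      norm (C * B * (g t + (\<Sum>j\<in>UNIV. g t * (t $ j) ^ (2 * m))))"
  proof (intro AE_I2)
    fix t
    have "norm (w t) * g t \<le> (C * (B * (1 + (\<Sum>j\<in>UNIV. (t $ j) ^ (2 * m))))) * g t"
      using nonneg w[of t] C unfolding B_def
      by (intro mult_right_mono order_trans[OF w] mult_left_mono power_norm_le_sum) auto
    also have "\<dots> = C * B * (g t + (\<Sum>j\<in>UNIV. g t * (t $ j) ^ (2 * m)))"
      by (simp add: algebra_simps sum_distrib_left)
    finally show "norm (w t * complex_of_real (g t)) \<le>
        norm (C * B * (g t + (\<Sum>j\<in>UNIV. g t * (t $ j) ^ (2 * m))))"
      using nonneg[of t] by (simp add: norm_mult)
  qed
qed

text \<open>Each factor of the operator acts on \<open>exp (\<i> * (s \<bullet> t))\<close> as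
  multiplication by \<open>- \<i> * (t $ j - t $ i)\<close>. Differentiation under the integral is
  justified at every stage because the partial products \<open>w\<close> grow polynomially.\<close>

lemma foldr_partial_deriv_inverse_fourier:
  fixes g :: "real ^ 'n \<Rightarrow> real"
  assumes nonneg: "\<And>t. g t \<ge> 0" and g: "integrable lebesgue g" and smooth: "smooth (inverse_fourier g)"
  shows "foldr (\<lambda>(i, j) F s. - partial_deriv j F s - - partial_deriv i F s) xs (inverse_fourier g) =
    iexp_transform (\<lambda>t. (\<Prod>(i, j)\<leftarrow>xs. - \<i> * of_real (t $ j - t $ i)) * of_real (g t))"
proof (induction xs)
  case Nil
  then show ?case
    by (simp add: inverse_fourier_eq)
next
  case (Cons x xs)
  obtain i j where x: "x = (i, j)"
    by force
  define w where "w t = (\<Prod>(i, j)\<leftarrow>xs. - \<i> * of_real (t $ j - t $ i) :: complex)" for t :: "real ^ 'n"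
  have w_meas[measurable]: "w \<in> borel_measurable lebesgue"
    unfolding w_def[abs_def] by (induction xs) (auto simp: case_prod_unfold)
  have w: "norm (w t) \<le> 2 ^ length xs * (1 + norm t) ^ length xs" for t
  proof -
    define c where "c = 1 + norm t"
    have c: "0 \<le> c"
      by (simp add: c_def)
    have "norm (\<Prod>(i, j)\<leftarrow>xs. - \<i> * of_real (t $ j - t $ i) :: complex) \<le> 2 ^ length xs * c ^ length xs"
    proof (induction xs)
      case (Cons x xs)
      obtain i j where x: "x = (i, j)"
        by force
      have "\<bar>t $ j - t $ i\<bar> \<le> \<bar>t $ j\<bar> + \<bar>t $ i\<bar>"
        by (rule abs_triangle_ineq4)
      also have "\<dots> \<le> norm t + norm t"
        by (intro add_mono component_le_norm_cart)
      also have "\<dots> \<le> 2 * c"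
        by (simp add: c_def)
      finally have "\<bar>t $ j - t $ i\<bar> \<le> 2 * c" .
      from mult_mono[OF this Cons.IH] show ?case
        by (simp add: x norm_mult mult_ac c flip: of_real_diff)
    qed simp
    then show ?thesis
      by (simp add: w_def c_def)
  qed
  have int: "integrable lebesgue (\<lambda>t. w t * of_real (g t))"
    by (rule integrable_poly_growth_smooth[OF nonneg g smooth w_meas w])
  \<comment> \<open>One more coordinate factor raises the growth exponent by one; this is the
    integrability that differentiating the transform of \<open>w g\<close> requires.\<close>
  have "integrable lebesgue (\<lambda>t. (of_real (t $ k) * w t) * of_real (g t))" for k
  proof (rule integrable_poly_growth_smooth[OF nonneg g smooth])
    show "norm (of_real (t $ k) * w t) \<le> 2 ^ length xs * (1 + norm t) ^ Suc (length xs)" for t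
    proof -
      have "\<bar>t $ k\<bar> \<le> 1 + norm t"
        using component_le_norm_cart[of t k] norm_ge_zero[of t] by linarith
      from mult_mono[OF this w] show ?thesis
        by (simp add: norm_mult mult_ac)
    qed
  qed measurable
  then have int': "integrable lebesgue (\<lambda>t. of_real (t $ k) * (w t * of_real (g t)))" for k
    by (simp add: mult.assoc)
  have int'': "integrable lebesgue (\<lambda>t. \<i> * of_real (t $ k) * (w t * of_real (g t)) * exp (\<i> * of_real (s \<bullet> t)))" for k s
    using integrable_mult_right[OF integrable_mult_iexp[OF int'[of k], of s], of \<i>] by (simp add: mult.assoc)
  have "foldr (\<lambda>(i, j) F s. - partial_deriv j F s - - partial_deriv i F s) (x # xs) (inverse_fourier g) =
      (\<lambda>s. - iexp_transform (\<lambda>t. \<i> * of_real (t $ j) * (w t * of_real (g t))) s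
         - - iexp_transform (\<lambda>t. \<i> * of_real (t $ i) * (w t * of_real (g t))) s)"
    by (simp only: foldr.simps o_apply x prod.case Cons.IH w_def[symmetric] partial_deriv_iexp_transform[OF int int'])
  also have "\<dots> = iexp_transform (\<lambda>t. (- \<i> * of_real (t $ j - t $ i)) * w t * of_real (g t))"
  proof
    fix s
    show "- iexp_transform (\<lambda>t. \<i> * of_real (t $ j) * (w t * of_real (g t))) s
         - - iexp_transform (\<lambda>t. \<i> * of_real (t $ i) * (w t * of_real (g t))) s =
        iexp_transform (\<lambda>t. (- \<i> * of_real (t $ j - t $ i)) * w t * of_real (g t)) s"
      using Bochner_Integration.integral_diff[OF int''[of i s] int''[of j s]]
      unfolding iexp_transform_def by (simp add: algebra_simps)
  qed
  finally show ?case
    by (simp add: x w_def mult.assoc)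
qed

text \<open>The list of pairs meets each \<open>k < l\<close> exactly once, so its product is the
  Vandermonde product with one factor \<open>- \<i>\<close> per pair.\<close>

lemma vandermonde_op_inverse_fourier:
  fixes g :: "real ^ 'n::{finite,linorder} \<Rightarrow> real"
  assumes nonneg: "\<And>t. g t \<ge> 0" and g: "integrable lebesgue g" and smooth: "smooth (inverse_fourier g)"
  shows "vandermonde_op (\<lambda>j F s. - partial_deriv j F s) (inverse_fourier g) =
    iexp_transform (\<lambda>t. (- \<i>) ^ card {(k :: 'n, l). k < l} * of_real (vandermonde t) * of_real (g t))"
proof -
  define us where "us = sorted_list_of_set (UNIV :: 'n set)"
  define ps where "ps = [(i, j). i \<leftarrow> us, j \<leftarrow> us, i < j]"
  \<comment> \<open>As a filtered product of distinct lists, \<open>ps\<close> is seen to be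
    distinct.\<close>
  have "ps = filter (\<lambda>(i, j). i < j) (List.product us us)"
  proof -
    have "concat (map (\<lambda>j. if i < j then [(i, j)] else []) vs) =
        filter (\<lambda>(i, j). i < j) (map (Pair i) vs)" for i :: 'n and vs
      by (induction vs) auto
    then have "[(i, j). i \<leftarrow> xs, j \<leftarrow> vs, i < j] = filter (\<lambda>(i, j). i < j) (List.product xs vs)"
      for xs vs :: "'n list"
      by (induction xs) auto
    then show ?thesis
      by (simp add: ps_def)
  qed
  then have ps: "distinct ps" "set ps = {(k, l). k < l}"
    by (auto simp: us_def distinct_product)
  have prod: "(\<Prod>(i, j)\<leftarrow>ps. - \<i> * of_real (t $ j - t $ i)) =
      (- \<i>) ^ card {(k :: 'n, l). k < l} * of_real (vandermonde t)" for t :: "real ^ 'n::{finite,linorder}"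
    by (subst prod.distinct_set_conv_list[symmetric, OF ps(1)])
      (simp only: ps(2) vandermonde_def case_prod_unfold prod.distrib prod_constant of_real_prod)
  show "vandermonde_op (\<lambda>j F s. - partial_deriv j F s) (inverse_fourier g) =
    iexp_transform (\<lambda>t. (- \<i>) ^ card {(k :: 'n, l). k < l} * of_real (vandermonde t) * of_real (g t))"
    unfolding vandermonde_op_def us_def[symmetric] ps_def[symmetric]
    using foldr_partial_deriv_inverse_fourier[OF nonneg g smooth, of ps] by (simp only: prod)
qed

subsection \<open>Antisymmetrisation\<close>

text \<open>In the Leibniz expansion the sign of \<open>p\<close> is absorbed by the Vandermonde
  factor, so each term is \<open>H\<close> at a permuted point. Permutations preserve Lebesgue
  measure, so all terms have the same integral.\<close>

lemma antisymmetrized_iexp_transform: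
  fixes g :: "real ^ 'n::{finite,linorder} \<Rightarrow> real"
  assumes sym: "symmetric_fun g" and int: "integrable lebesgue (\<lambda>t. g t * vandermonde t)"
  shows "(\<integral>t. of_real (g t) * of_real (vandermonde t) *
      det (\<chi> k l. exp (\<i> * of_real (s $ k * t $ l))) \<partial>lebesgue) =
    fact CARD('n) * iexp_transform (\<lambda>t. of_real (g t * vandermonde t)) s"
proof -
  define H where "H t = of_real (g t * vandermonde t) * exp (\<i> * of_real (s \<bullet> t))" for t
  have H: "integrable lebesgue H"
    unfolding H_def[abs_def] by (intro integrable_mult_iexp integrable_of_real int)
  note [measurable] = borel_measurable_integrable[OF H]
  have summand: "of_real (g t) * of_real (vandermonde t) *
      (of_int (sign p) * (\<Prod>k\<in>UNIV. exp (\<i> * of_real (s $ k * t $ p k)))) = H (\<chi> i. t $ p i)"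
    if p: "p permutes UNIV" for p t
  proof -
    have "(\<Prod>k\<in>UNIV. exp (\<i> * of_real (s $ k * t $ p k))) = exp (\<i> * of_real (s \<bullet> (\<chi> i. t $ p i)))"
      by (simp add: inner_vec_def exp_sum[symmetric] sum_distrib_left del: of_real_mult)
    moreover have "g (\<chi> i. t $ p i) = g t"
      using sym p by (auto simp: symmetric_fun_def)
    ultimately show ?thesis
      by (simp add: H_def vandermonde_permute[OF p] mult_ac)
  qed
  have "(\<integral>t. of_real (g t) * of_real (vandermonde t) *
      det (\<chi> k l. exp (\<i> * of_real (s $ k * t $ l))) \<partial>lebesgue) =
      (\<integral>t. (\<Sum>p\<in>{p. p permutes (UNIV :: 'n set)}. H (\<chi> i. t $ p i)) \<partial>lebesgue)"
    unfolding det_def sum_distrib_left vec_lambda_beta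
    by (intro Bochner_Integration.integral_cong refl sum.cong summand) simp
  also have "\<dots> = (\<Sum>p\<in>{p. p permutes (UNIV :: 'n set)}. \<integral>t. H (\<chi> i. t $ p i) \<partial>lebesgue)"
    by (intro Bochner_Integration.integral_sum) (simp add: integral_lebesgue_permute H)
  also have "\<dots> = (\<Sum>p\<in>{p. p permutes (UNIV :: 'n set)}. integral\<^sup>L lebesgue H)"
    by (intro sum.cong) (simp_all add: integral_lebesgue_permute)
  also have "\<dots> = fact CARD('n) * integral\<^sup>L lebesgue H"
    by (simp add: card_permutations[OF refl])
  also have "integral\<^sup>L lebesgue H = iexp_transform (\<lambda>t. of_real (g t * vandermonde t)) s"
    unfolding iexp_transform_def H_def[abs_def] ..
  finally show ?thesis .
qed

section \<open>Fubini for product densities\<close>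

text \<open>Cylinders over null sets are null. Measurability into the completed line makes
  \<open>\<gamma> (t $ i)\<close> measurable for \<open>\<gamma>\<close> that is only Lebesgue
  measurable.\<close>

lemma lebesgue_measurable_component_lebesgue:
  "(\<lambda>t :: real ^ 'n. t $ i) \<in> lebesgue \<rightarrow>\<^sub>M lebesgue"
proof (rule completion.measurable_completion2)
  show *: "(\<lambda>t :: real ^ 'n. t $ i) \<in> lebesgue \<rightarrow>\<^sub>M lborel"
    by (rule measurable_completion) simp
  show "null_sets lborel \<subseteq> null_sets (distr lebesgue lborel (\<lambda>t :: real ^ 'n. t $ i))"
  proof
    fix N :: "real set" assume N: "N \<in> null_sets lborel"
    then have "AE t in (lborel :: (real ^ 'n) measure). t $ i \<notin> N"
      by (intro AE_lborel_component AE_not_in)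
    then have "AE t in (lebesgue :: (real ^ 'n) measure). t $ i \<notin> N"
      by (rule AE_completion)
    moreover have "(\<lambda>t :: real ^ 'n. t $ i) -` N \<in> sets lebesgue"
      using measurable_sets[OF *, of N] N by auto
    ultimately have "(\<lambda>t :: real ^ 'n. t $ i) -` N \<in> null_sets lebesgue"
      by (subst AE_iff_null_sets) auto
    then show "N \<in> null_sets (distr lebesgue lborel (\<lambda>t :: real ^ 'n. t $ i))"
      using N * by (subst null_sets_distr_iff) auto
  qed
qed

text \<open>Expanding the Vandermonde determinant over permutations gives products of functions of
  one coordinate each. Fubini integrates every product, and the Leibniz formula reassembles a
  determinant.\<close>

lemma product_vandermonde_lborel:
  fixes \<beta> :: "real \<Rightarrow> real" and s :: "real ^ 'n::{finite,linorder}"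
  assumes \<beta>: "\<And>k :: 'n. integrable lborel (\<lambda>u. \<beta> u * u ^ index_pred k)"
  defines "F \<equiv> \<lambda>t :: real ^ 'n::{finite,linorder}. of_real ((\<Prod>i\<in>UNIV. \<beta> (t $ i)) * vandermonde t) * exp (\<i> * of_real (s \<bullet> t))"
  shows "integrable lborel F"
    and "integral\<^sup>L lborel F = det (\<chi> k l. \<integral>u. of_real (\<beta> u) * of_real (u ^ index_pred k) *
      exp (\<i> * of_real u * of_real (s $ l)) \<partial>lborel)"
proof -
  define h where "h k l u = complex_of_real (\<beta> u) * of_real (u ^ index_pred k) * exp (\<i> * of_real u * of_real (s $ l))"
    for k l :: 'n and u
  have h: "integrable lborel (h k l)" for k l
  proof -
    have int: "integrable lborel (\<lambda>u. complex_of_real (\<beta> u * u ^ index_pred k))"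
      by (intro integrable_of_real \<beta>)
    note [measurable] = borel_measurable_integrable[OF int]
    have "integrable lborel (\<lambda>u. complex_of_real (\<beta> u * u ^ index_pred k) * exp (\<i> * of_real (u * s $ l)))"
      by (rule Bochner_Integration.integrable_bound[OF int])
        (auto simp: norm_mult norm_exp_i_times simp del: of_real_mult)
    then show ?thesis
      by (simp add: h_def[abs_def] mult.assoc)
  qed
  have F_eq: "F = (\<lambda>t. \<Sum>p\<in>{p. p permutes (UNIV :: 'n set)}. of_int (sign p) * (\<Prod>l\<in>UNIV. h (p l) l (t $ l)))"
  proof
    fix t :: "real ^ 'n::{finite,linorder}"
    have "exp (\<i> * of_real (s \<bullet> t)) = (\<Prod>l\<in>UNIV. exp (\<i> * of_real (t $ l) * of_real (s $ l)))"
      by (simp add: inner_vec_def exp_sum sum_distrib_left mult_ac)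
    \<comment> \<open>The transpose lets \<open>p\<close> act on the exponents while the coordinate
      index \<open>l\<close> stays fixed, matching the factors \<open>h (p l) l\<close>.\<close>
    moreover have "vandermonde t = (\<Sum>p\<in>{p. p permutes (UNIV :: 'n set)}. of_int (sign p) * (\<Prod>l\<in>UNIV. t $ l ^ index_pred (p l)))"
      by (subst vandermonde_eq_det, subst det_transpose[symmetric]) (simp add: det_def transpose_def)
    ultimately show "F t = (\<Sum>p\<in>{p. p permutes (UNIV :: 'n set)}. of_int (sign p) * (\<Prod>l\<in>UNIV. h (p l) l (t $ l)))"
      by (simp add: F_def h_def prod.distrib sum_distrib_left sum_distrib_right mult_ac)
  qed
  have int: "integrable lborel (\<lambda>t :: real ^ 'n::{finite,linorder}. of_int (sign p) * (\<Prod>l\<in>UNIV. h (p l) l (t $ l)))" for p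
    by (intro integrable_mult_right integrable_lborel_prod_components h)
  then show "integrable lborel F"
    unfolding F_eq by (rule Bochner_Integration.integrable_sum)
  have "integral\<^sup>L lborel F = (\<Sum>p\<in>{p. p permutes (UNIV :: 'n set)}. of_int (sign p) * (\<Prod>l\<in>UNIV. integral\<^sup>L lborel (h (p l) l)))"
    unfolding F_eq Bochner_Integration.integral_sum[OF int] integral_mult_right_zero
      integral_lborel_prod_components[of "\<lambda>l. h (_ l) l", OF h] ..
  also have "\<dots> = det (\<chi> k l. integral\<^sup>L lborel (h k l))"
    by (subst det_transpose[symmetric]) (simp add: det_def transpose_def)
  finally show "integral\<^sup>L lborel F = det (\<chi> k l. \<integral>u. of_real (\<beta> u) * of_real (u ^ index_pred k) *
      exp (\<i> * of_real u * of_real (s $ l)) \<partial>lborel)"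
    by (simp add: h_def[abs_def])
qed

text \<open>Reduction to the Borel case: \<open>\<gamma>\<close> is replaced by a Borel function
  equal to it almost everywhere. Null sets of the line give null cylinders, so no integral
  changes.\<close>

lemma product_vandermonde_lebesgue:
  fixes \<gamma> :: "real \<Rightarrow> real" and s :: "real ^ 'n::{finite,linorder}"
  assumes \<gamma>[measurable]: "\<gamma> \<in> borel_measurable lebesgue" and nonneg: "\<And>u. 0 \<le> \<gamma> u"
    and int: "integrable lebesgue (\<lambda>t :: real ^ 'n::{finite,linorder}. (\<Prod>i\<in>UNIV. \<gamma> (t $ i)) * (vandermonde t)\<^sup>2)"
  shows "integrable lebesgue (\<lambda>t :: real ^ 'n::{finite,linorder}. (\<Prod>i\<in>UNIV. \<gamma> (t $ i)) * vandermonde t)"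
    and "iexp_transform (\<lambda>t. of_real ((\<Prod>i\<in>UNIV. \<gamma> (t $ i)) * vandermonde t)) s =
      det (\<chi> k l. \<integral>u. of_real (\<gamma> u) * of_real (u ^ index_pred k) *
        exp (\<i> * of_real u * of_real (s $ l)) \<partial>lebesgue)"
proof -
  obtain \<beta>' where \<beta>': "\<beta>' \<in> borel_measurable borel" "AE u in lborel. \<gamma> u = \<beta>' u"
    using completion_ex_borel_measurable_real[OF \<gamma>] by auto
  \<comment> \<open>The absolute value makes the function nonnegative everywhere, and it still
    agrees with \<open>\<gamma>\<close> almost everywhere.\<close>
  define \<beta> where "\<beta> u = \<bar>\<beta>' u\<bar>" for u
  have \<beta>_nonneg: "0 \<le> \<beta> u" for u
    by (simp add: \<beta>_def)
  have [measurable]: "\<beta> \<in> borel_measurable borel"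
    using \<beta>'(1) unfolding \<beta>_def by measurable
  have \<beta>_leb[measurable]: "\<beta> \<in> borel_measurable lebesgue"
    by (rule measurable_completion) simp
  have AE: "AE u in lborel. \<gamma> u = \<beta> u"
    using \<beta>'(2)
  proof eventually_elim
    case (elim u)
    then show ?case
      using nonneg[of u] by (simp add: \<beta>_def)
  qed
  have comp[measurable]: "(\<lambda>t :: real ^ 'n::{finite,linorder}. \<gamma> (t $ i)) \<in> borel_measurable lebesgue" for i
    by (rule measurable_compose[OF lebesgue_measurable_component_lebesgue \<gamma>])
  have [measurable]: "(vandermonde :: real ^ 'n::{finite,linorder} \<Rightarrow> real) \<in> borel_measurable lebesgue"
    by (rule measurable_completion) simp
  have "AE t in (lborel :: (real ^ 'n::{finite,linorder}) measure). \<forall>i. \<gamma> (t $ i) = \<beta> (t $ i)"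
    by (intro eventually_all_finite AE_lborel_component AE)
  then have AE_prod: "AE t in (lebesgue :: (real ^ 'n::{finite,linorder}) measure). (\<Prod>i\<in>UNIV. \<gamma> (t $ i)) = (\<Prod>i\<in>UNIV. \<beta> (t $ i))"
    by (intro AE_completion) (auto elim!: eventually_mono)
  define P where "P t = (\<Prod>i\<in>UNIV. \<beta> (t $ i))" for t :: "real ^ 'n::{finite,linorder}"
  have [measurable]: "P \<in> borel_measurable borel"
    unfolding P_def[abs_def] by measurable
  have [measurable]: "P \<in> borel_measurable lebesgue"
    by (rule measurable_completion) simp
  have "integrable lebesgue (\<lambda>t. P t * (vandermonde t)\<^sup>2)"
    by (rule integrable_cong_AE_imp[OF int]) (use AE_prod in \<open>auto simp: P_def elim!: eventually_mono\<close>)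
  then have "integrable lborel (\<lambda>t. P t * (vandermonde t)\<^sup>2)"
    by (subst (asm) integrable_completion) auto
  then have \<beta>: "integrable lborel (\<lambda>u. \<beta> u * u ^ index_pred k)" for k :: 'n
    unfolding P_def by (intro integrable_moments_lborel) (auto simp: \<beta>_nonneg)
  note F = product_vandermonde_lborel[OF \<beta>, folded P_def]
  \<comment> \<open>At \<open>s = 0\<close> the exponential is \<open>1\<close>, which yields
    integrability of the real product.\<close>
  have "integrable lborel (\<lambda>t. Re (of_real (P t * vandermonde t) * exp (\<i> * of_real (0 \<bullet> t))))"
    by (intro integrable_Re F)
  then have "integrable lborel (\<lambda>t. P t * vandermonde t)"
    by simp
  then have "integrable lebesgue (\<lambda>t. P t * vandermonde t)"
    by (subst integrable_completion) auto
  then show "integrable lebesgue (\<lambda>t :: real ^ 'n::{finite,linorder}. (\<Prod>i\<in>UNIV. \<gamma> (t $ i)) * vandermonde t)"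
    by (rule integrable_cong_AE_imp) (use AE_prod in \<open>auto simp: P_def elim!: eventually_mono\<close>)
  have "iexp_transform (\<lambda>t. of_real ((\<Prod>i\<in>UNIV. \<gamma> (t $ i)) * vandermonde t)) s =
      iexp_transform (\<lambda>t. of_real (P t * vandermonde t)) s"
    unfolding iexp_transform_def
    by (rule integral_cong_AE) (use AE_prod in \<open>auto simp: P_def simp del: of_real_prod elim!: eventually_mono\<close>)
  also have "\<dots> = (\<integral>t. of_real (P t * vandermonde t) * exp (\<i> * of_real (s \<bullet> t)) \<partial>lborel)"
    unfolding iexp_transform_def by (rule integral_completion) simp
  also have "\<dots> = det (\<chi> k l. \<integral>u. of_real (\<beta> u) * of_real (u ^ index_pred k) *
      exp (\<i> * of_real u * of_real (s $ l)) \<partial>lborel)"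
    by (rule F)
  finally have lborel: "iexp_transform (\<lambda>t. of_real ((\<Prod>i\<in>UNIV. \<gamma> (t $ i)) * vandermonde t)) s =
      det (\<chi> k l. \<integral>u. of_real (\<beta> u) * of_real (u ^ index_pred k) *
        exp (\<i> * of_real u * of_real (s $ l)) \<partial>lborel)" .
  have entry: "(\<integral>u. of_real (\<beta> u) * of_real (u ^ index_pred k) * exp (\<i> * of_real u * of_real (s $ l)) \<partial>lborel) =
      (\<integral>u. of_real (\<gamma> u) * of_real (u ^ index_pred k) * exp (\<i> * of_real u * of_real (s $ l)) \<partial>lebesgue)"
    for k l :: 'n
  proof -
    have [measurable]: "(\<lambda>u :: real. u) \<in> borel_measurable lebesgue"
      by (rule measurable_completion) simp
    show ?thesis
      by (subst integral_completion[symmetric], simp, rule integral_cong_AE)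
        (use AE_completion[OF AE] in \<open>auto elim!: eventually_mono\<close>)
  qed
  show "iexp_transform (\<lambda>t. of_real ((\<Prod>i\<in>UNIV. \<gamma> (t $ i)) * vandermonde t)) s =
      det (\<chi> k l. \<integral>u. of_real (\<gamma> u) * of_real (u ^ index_pred k) *
        exp (\<i> * of_real u * of_real (s $ l)) \<partial>lebesgue)"
    unfolding lborel entry ..
qed

subsection \<open>Evaluation at the eigenvalues\<close>

text \<open>A root of the characteristic polynomial has an eigenvector \<open>v\<close>, and the
  positive form at \<open>v\<close> is the root times the squared norm of \<open>v\<close>.\<close>

lemma eigenvalue_list_pos:
  fixes x :: "complex ^ 'n ^ 'n"
  assumes x: "x \<in> hpd" and r: "eigenvalue_list x r"
  shows "0 < r $ k"
proof -
  have "det (mat (of_real (r $ k)) - x) = (\<Prod>j\<in>UNIV. of_real (r $ k) - of_real (r $ j))"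
    using r by (simp add: eigenvalue_list_def)
  also have "\<dots> = 0"
    by (rule prod_zero) auto
  finally have "\<not> invertible (mat (of_real (r $ k)) - x)"
    by (simp add: invertible_det_nz)
  then obtain v where v: "v \<noteq> 0" "(mat (of_real (r $ k)) - x) *v v = 0"
    unfolding invertible_left_inverse matrix_left_invertible_ker by auto
  have "mat (of_real (r $ k)) *v v = of_real (r $ k) *s v"
    by (simp add: vec_eq_iff matrix_vector_mult_def mat_def if_distrib if_distribR cong: if_cong)
  then have xv: "x *v v = of_real (r $ k) *s v"
    using v(2) by (simp add: matrix_vector_mult_diff_rdistrib)
  have "(\<Sum>i\<in>UNIV. cnj (v $ i) * (x *v v) $ i) = of_real (r $ k * (\<Sum>i\<in>UNIV. (norm (v $ i))\<^sup>2))"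
    unfolding xv by (simp add: sum_distrib_left complex_norm_square mult_ac del: of_real_power)
  moreover have "0 < Re (\<Sum>i\<in>UNIV. cnj (v $ i) * (x *v v) $ i)"
    using x v(1) unfolding hpd_def by blast
  ultimately have "0 < r $ k * (\<Sum>i\<in>UNIV. (norm (v $ i))\<^sup>2)"
    by (simp only: Re_complex_of_real)
  moreover have "0 \<le> (\<Sum>i\<in>UNIV. (norm (v $ i))\<^sup>2)"
    by (rule sum_nonneg) simp
  ultimately show ?thesis
    by (simp add: zero_less_mult_iff)
qed

text \<open>The characteristic polynomial is evaluated at \<open>0\<close>; the signs
  \<open>(-1) ^ CARD('n)\<close> cancel.\<close>

lemma eigenvalue_list_det:
  fixes x :: "complex ^ 'n ^ 'n"
  assumes "eigenvalue_list x r"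
  shows "det x = of_real (\<Prod>k\<in>UNIV. r $ k)"
proof -
  have "det (- x) = (\<Prod>k\<in>UNIV. - of_real (r $ k))"
    using assms[unfolded eigenvalue_list_def, rule_format, of 0] by simp
  moreover have "det (\<chi> i. - (x $ i)) = (-1) ^ CARD('n) * det x"
    using det_rows_mul[of "\<lambda>_. -1" "\<lambda>i. x $ i"] by (simp add: vec_lambda_eta vector_sneg_minus1[symmetric])
  moreover have "(\<chi> i. - (x $ i)) = - x"
    by (simp add: vec_eq_iff)
  moreover have "(\<Prod>k\<in>UNIV. - complex_of_real (r $ k)) = (-1) ^ CARD('n) * of_real (\<Prod>k\<in>UNIV. r $ k)"
    by (simp add: prod_uminus)
  ultimately show ?thesis
    by simp
qed

text \<open>Row \<open>k\<close> has the common factor \<open>r $ k powr c\<close>. These powers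
  multiply because the bases are positive, so their principal logarithms are real and add
  up.\<close>

lemma det_powr_factor:
  fixes r :: "real ^ 'n" and t :: "real ^ 'n" and c :: complex
  assumes pos: "\<And>k. 0 < r $ k"
  shows "det (\<chi> k l. complex_of_real (r $ k) powr (\<i> * of_real (t $ l) + c)) =
    of_real (\<Prod>k\<in>UNIV. r $ k) powr c * det (\<chi> k l. exp (\<i> * of_real (ln (r $ k) * t $ l)))"
proof -
  have "(\<chi> k l. complex_of_real (r $ k) powr (\<i> * of_real (t $ l) + c)) =
      (\<chi> k. (of_real (r $ k) powr c) *s (\<chi> l. exp (\<i> * of_real (ln (r $ k) * t $ l))))"
    using pos by (simp add: vec_eq_iff powr_def Ln_of_real exp_add[symmetric] less_imp_neq[symmetric] algebra_simps)
  moreover have "(\<Prod>k\<in>UNIV. complex_of_real (r $ k) powr c) = of_real (\<Prod>k\<in>UNIV. r $ k) powr c"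
  proof -
    have "0 < (\<Prod>k\<in>UNIV. r $ k)"
      using pos by (simp add: prod_pos)
    moreover have "ln (\<Prod>k\<in>UNIV. r $ k) = (\<Sum>k\<in>UNIV. ln (r $ k))"
      using pos by (intro ln_prod) (auto simp: less_imp_neq[symmetric])
    ultimately show ?thesis
      using pos by (simp add: powr_def Ln_of_real exp_sum[symmetric] sum_distrib_left less_imp_neq[symmetric] del: of_real_prod)
  qed
  ultimately show ?thesis
    by (simp add: det_rows_mul)
qed

text \<open>Both limits are taken within the regular set, where the functions agree.\<close>

lemma eq_by_continuity_atI:
  assumes "\<And>y. y \<in> hpd_regular \<Longrightarrow> F y = G y"
  shows "eq_by_continuity_at x F G"
proof -
  have "(F \<longlongrightarrow> L) (at x within hpd_regular) \<longleftrightarrow> (G \<longlongrightarrow> L) (at x within hpd_regular)" for L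
    by (rule Lim_cong_within) (auto simp: assms)
  then show ?thesis
    by (simp add: eq_by_continuity_at_def assms)
qed

theorem proposition6:
  fixes g :: "real ^ ('n::{finite,linorder}) \<Rightarrow> real"
    and \<rho> :: "complex ^ ('n::{finite,linorder}) ^ ('n::{finite,linorder}) \<Rightarrow> real ^ ('n::{finite,linorder})"
    and f :: "complex ^ ('n::{finite,linorder}) ^ ('n::{finite,linorder}) \<Rightarrow> complex"
  assumes g_nonneg: "\<And>t. g t \<ge> 0"
    and g_sym: "symmetric_fun g"
    and g_int: "integrable lebesgue (\<lambda>t. g t * (vandermonde t)\<^sup>2)"
    and rho: "\<And>x. x \<in> hpd \<Longrightarrow> eigenvalue_list x (\<rho> x)"
    and f: "\<And>x. x \<in> hpd_regular \<Longrightarrow>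
      f x = 1 / vandermonde (\<chi> k. \<i> * of_real (\<rho> x $ k)) *
        (1 / fact CARD('n) *
          (\<integral>t. of_real (g t) * of_real (vandermonde t) *
             det (\<chi> k l. complex_of_real (\<rho> x $ k) powr
                    (\<i> * of_real (t $ l) + (of_nat CARD('n) - 1) / 2)) \<partial>lebesgue))"
  shows
    "(\<forall>\<gamma> :: real \<Rightarrow> real.
        \<gamma> \<in> borel_measurable lebesgue \<and> (\<forall>u. \<gamma> u \<ge> 0) \<and> (\<forall>t. g t = (\<Prod>i\<in>UNIV. \<gamma> (t $ i))) \<longrightarrow>
        (\<forall>x \<in> hpd. eq_by_continuity_at x f
          (\<lambda>x. det x powr ((of_nat CARD('n) - 1) / 2) / vandermonde (\<chi> k. \<i> * of_real (\<rho> x $ k)) *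
             det (\<chi> k l. \<integral>u. of_real (\<gamma> u) * of_real (u ^ index_pred k) *
                            exp (\<i> * of_real u * of_real (ln (\<rho> x $ l))) \<partial>lebesgue))))
     \<and>
     (integrable lebesgue g \<and> smooth (inverse_fourier g) \<longrightarrow>
        (\<forall>x \<in> hpd. eq_by_continuity_at x f
          (\<lambda>x. det x powr ((of_nat CARD('n) - 1) / 2) / of_real (vandermonde (\<rho> x)) *
             vandermonde_op (\<lambda>j F s. - partial_deriv j F s) (inverse_fourier g)
               (\<chi> l. ln (\<rho> x $ l)))))"
proof -
  define c where "c = (of_nat CARD('n) - 1 :: complex) / 2"
  \<comment> \<open>Shared by both parts: the power of the determinant leaves the integral, and
    antisymmetrisation cancels \<open>1 / fact CARD('n)\<close>.\<close>
  have f_eq: "f x = det x powr c / vandermonde (\<chi> k. \<i> * of_real (\<rho> x $ k)) *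
      iexp_transform (\<lambda>t. of_real (g t * vandermonde t)) (\<chi> l. ln (\<rho> x $ l))"
    if int: "integrable lebesgue (\<lambda>t. g t * vandermonde t)" and x: "x \<in> hpd_regular" for x
  proof -
    have "x \<in> hpd"
      using x by (simp add: hpd_regular_def)
    note ev = rho[OF this] and pos = eigenvalue_list_pos[OF this rho[OF this]]
    have "(\<integral>t. of_real (g t) * of_real (vandermonde t) *
        det (\<chi> k l. complex_of_real (\<rho> x $ k) powr (\<i> * of_real (t $ l) + c)) \<partial>lebesgue) =
      (\<integral>t. det x powr c * (of_real (g t) * of_real (vandermonde t) *
        det (\<chi> k l. exp (\<i> * of_real ((\<chi> l. ln (\<rho> x $ l)) $ k * t $ l)))) \<partial>lebesgue)"
      by (simp add: det_powr_factor[OF pos] eigenvalue_list_det[OF ev] mult_ac del: of_real_mult)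
    also have "\<dots> = det x powr c * (fact CARD('n) *
        iexp_transform (\<lambda>t. of_real (g t * vandermonde t)) (\<chi> l. ln (\<rho> x $ l)))"
      unfolding antisymmetrized_iexp_transform[OF g_sym int, symmetric] by simp
    finally show ?thesis
      unfolding f[OF x] c_def[symmetric] by simp
  qed
  show ?thesis
    unfolding c_def[symmetric]
  proof (intro conjI allI impI ballI eq_by_continuity_atI; elim conjE)
    fix \<gamma> :: "real \<Rightarrow> real" and x :: "complex ^ 'n::{finite,linorder} ^ 'n::{finite,linorder}"
    assume \<gamma>: "\<gamma> \<in> borel_measurable lebesgue" "\<forall>u. \<gamma> u \<ge> 0" "\<forall>t. g t = (\<Prod>i\<in>UNIV. \<gamma> (t $ i))"
      and x: "x \<in> hpd_regular"
    have g: "g = (\<lambda>t. \<Prod>i\<in>UNIV. \<gamma> (t $ i))"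
      using \<gamma>(3) by auto
    note prod = product_vandermonde_lebesgue[OF \<gamma>(1) \<gamma>(2)[rule_format] g_int[unfolded g], folded g]
    show "f x = det x powr c / vandermonde (\<chi> k. \<i> * of_real (\<rho> x $ k)) *
        det (\<chi> k l. \<integral>u. of_real (\<gamma> u) * of_real (u ^ index_pred k) *
          exp (\<i> * of_real u * of_real (ln (\<rho> x $ l))) \<partial>lebesgue)"
      using prod(2)[of "\<chi> l. ln (\<rho> x $ l)"] \<gamma>(3) f_eq[OF _ x] prod(1) by simp
  next
    fix x :: "complex ^ 'n::{finite,linorder} ^ 'n::{finite,linorder}"
    assume g: "integrable lebesgue g" "smooth (inverse_fourier g)" and x: "x \<in> hpd_regular"
    define d where "d = card {(k :: 'n, l). k < l}"
    let ?s = "\<chi> l. ln (\<rho> x $ l)"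
    have "(vandermonde :: real ^ 'n::{finite,linorder} \<Rightarrow> real) \<in> borel_measurable lebesgue"
      by (rule measurable_completion) simp
    then have int: "integrable lebesgue (\<lambda>t. g t * vandermonde t)"
      by (rule integrable_mult_if_square[OF g(1) g_int g_nonneg])
    \<comment> \<open>The denominator carries one factor \<open>\<i>\<close> per pair; its inverse
      is the power of \<open>- \<i>\<close> that the differential operator produces.\<close>
    have V: "vandermonde (\<chi> k. \<i> * of_real (\<rho> x $ k)) = \<i> ^ d * of_real (vandermonde (\<rho> x))"
      using vandermonde_smult[of \<i> "\<chi> k. of_real (\<rho> x $ k)"] vandermonde_of_real[of "\<rho> x"]
      by (simp add: d_def)
    have "vandermonde_op (\<lambda>j F s. - partial_deriv j F s) (inverse_fourier g) ?s =
        (- \<i>) ^ d * iexp_transform (\<lambda>t. of_real (g t * vandermonde t)) ?s"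
      unfolding vandermonde_op_inverse_fourier[OF g_nonneg g] iexp_transform_def d_def[symmetric]
      by (subst integral_mult_right_zero[symmetric]) (simp add: mult_ac)
    moreover have "inverse (\<i> ^ d) = (- \<i>) ^ d"
      by (rule inverse_unique) (simp flip: power_mult_distrib)
    ultimately show "f x = det x powr c / of_real (vandermonde (\<rho> x)) *
        vandermonde_op (\<lambda>j F s. - partial_deriv j F s) (inverse_fourier g) ?s"
      unfolding f_eq[OF int x] V
      by (simp only: divide_inverse inverse_mult_distrib mult_ac)
  qed
qed

end
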